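(* With the notation of the context and $U^{(o)}\ne0$, define for $V\in\mathbb R^{mN_p}$ the linear functional $$\mathcal L_H(V):=\frac{U^\top\mathcal M_H[V]U}{2\,U^\top\widetilde M_HU},\qquad \mathcal M_H[V]:=Q_{3p}\big[\Phi^\top D_{u}H(u_p)[\Phi V]\,\Phi\big],$$ and set $$F_H:=\widetilde R^{-\top}\big[(\widetilde B_H-\widetilde N_H)U-\widetilde{\mathcal Q}_H\big]-\gamma_HU^{(o)},\qquad \gamma_H:=\frac{(U^{(o)})^\top(\widetilde V_H^{(o)}+\widetilde B_{H,\Delta}^{(o)})U^{(o)}}{2\|U^{(o)}\|^2}.$$ Then the $H$–ECF/CPG equation $$\dot U^{(o)}=-\big(\widetilde N^{(o)}_{H,\mathrm{skw}}-\widetilde S_{\mathrm{skw}}-\widetilde K_H^{\mathrm{EC}}\big)U^{(o)}+\tfrac12\big(\widetilde B_H^{(o)}+\widetilde B_{H,\Delta}^{(o)}\big)U^{(o)}-\big(\widetilde{\mathcal Q}_H^{(o)}+\widetilde B_{H,\Delta}^{(o)}U^{(o)}\big)$$ is equivalent to $$\widetilde R\,\dot U+U^{(o)}\,\mathcal L_H(\dot U)=F_H .$$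
   Context: Physical setting. Repeated spatial indices $k$ are summed. The system is $\partial_tu+A_k(u)\partial_{x_k}u=0$, $u\in\mathbb R^m$ with values in an admissible set $\mathcal U$, $A_k=\partial_uF_k$. A smooth energy pair $(e,g_k)$ satisfies $\nabla_ue^\top A_k=\nabla_ug_k^\top$. On $\mathcal U$, $e>0$ and $\mathcal H_e=\nabla_u^2e$ is symmetric positive definite (SPD); $H(u)=\frac{2e(u)}{u^\top\mathcal H_e(u)u}\mathcal H_e(u)$, with eigenvalues in a fixed interval $[c_H,C_H]\subset(0,\infty)$. $G_k$ is a smooth symmetric matrix field with $g_k=\tfrac12u^\top G_ku$, and $G_k=H(A_k+\Delta A_k)$ defines $\Delta A_k$. Discrete setting. $\Omega\subset\mathbb R^d$ is an element with outward unit normal $n$, $V^p$ the polynomials of degree $\le p$, $N_p=\dim V^p$, $\{\phi_\alpha\}$ a time-independent $L^2$-orthonormal basis of $V^p$, $\Phi_\alpha=\phi_\alpha I_m$, $\Phi=[\Phi_1\cdots\Phi_{N_p}]$, and $u_p=\Phi U$ with $U(t)\in\mathbb R^{mN_p}$, so $\partial_tu_p=\Phi\dot U$. $X_{\mathrm{skw}}=\tfrac12(X-X^\top)$. $Q_{3p}$, $Q_{3p+1}^{\partial\Omega}$, $Q_{\mathrm{hi}(n)}$ ($n\ge3p+1$) are positive-weight quadratures (volume, face, volume) of exactness degrees $3p$, $3p+1$, $n$. For $X\in\{A,\Delta A\}$, $Y_{X,k,p+1}\in(V^{p+1})^{m\times m}$ is the componentwise discrete $L^2$ projection of $H(u_p)X_k(u_p)$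 onto $V^{p+1}$ with quadrature $Q_{\mathrm{hi}(n)}$. CPG operators: $(\widetilde M_H)_{\alpha\beta}=Q_{3p}[\Phi_\alpha^\top H(u_p)\Phi_\beta]$ (SPD); $(\widetilde N_H)_{\alpha\beta}=Q_{3p}[\Phi_\alpha^\top Y_{A,k,p+1}\partial_{x_k}\Phi_\beta]$; $(\widetilde V_H)_{\alpha\beta}=Q_{3p}[\Phi_\alpha^\top(\partial_{x_k}Y_{A,k,p+1})\Phi_\beta]$; $(\widetilde B_H)_{\alpha\beta}=Q^{\partial\Omega}_{3p+1}[\Phi_\alpha^\top Y_{A,k,p+1}\Phi_\beta n_k]$; $(\widetilde B_{H,\Delta})_{\alpha\beta}=Q^{\partial\Omega}_{3p+1}[\Phi_\alpha^\top Y_{\Delta A,k,p+1}\Phi_\beta n_k]$; $\dot{\widetilde M}_H=Q_{3p}[\Phi^\top D_uH(u_p)[\partial_tu_p]\Phi]$. $\widetilde{\mathcal Q}_H\in\mathbb R^{mN_p}$ is the given boundary/interface numerical flux functional. Orthogonalization. $\widetilde M_H=\widetilde R^\top\widetilde R$ with $\widetilde R$ upper triangular Cholesky; $U^{(o)}:=\widetilde RU$; $\widetilde X^{(o)}:=\widetilde R^{-\top}\widetilde X\widetilde R^{-1}$ for matrices; $\widetilde{\mathcal Q}_H^{(o)}:=\widetilde R^{-\top}\widetilde{\mathcal Q}_H$; $\widetilde S:=\dot{\widetilde R}\widetilde R^{-1}$. $H$–ECF closure. $\widetilde C_H:=\tfrac12(\dot{\widetilde M}_H^{(o)}+\widetilde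 V_H^{(o)}+\widetilde B_{H,\Delta}^{(o)})$, $\rho_H:=(U^{(o)})^\top\widetilde C_HU^{(o)}$, $\widetilde L_H:=\frac{\rho_H}{\|U^{(o)}\|^4}U^{(o)}(U^{(o)})^\top$, $\widetilde C_H^{\mathrm{EC}}:=\widetilde C_H-\widetilde L_H$, and $\widetilde K_H^{\mathrm{EC}}:=\dfrac{\widetilde C_H^{\mathrm{EC}}U^{(o)}(U^{(o)})^\top-U^{(o)}(U^{(o)})^\top\widetilde C_H^{\mathrm{EC}}}{\|U^{(o)}\|^2}$. *)

theory Defs
  imports "HOL-Analysis.Analysis"
begin

section \<open>Calculus and linear algebra\<close>

primrec cont_diff_on :: "nat \<Rightarrow> 'a::euclidean_space set \<Rightarrow> ('a \<Rightarrow> 'b::real_normed_vector) \<Rightarrow> bool" where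
  "cont_diff_on 0 S f \<longleftrightarrow> continuous_on S f"
| "cont_diff_on (Suc r) S f \<longleftrightarrow>
     (\<forall>x\<in>S. f differentiable (at x)) \<and>
     (\<forall>v. cont_diff_on r S (\<lambda>x. frechet_derivative f (at x) v))"

text \<open>Class C-infinity; meant for open sets.\<close>

definition smooth_on :: "'a::euclidean_space set \<Rightarrow> ('a \<Rightarrow> 'b::real_normed_vector) \<Rightarrow> bool" where
  "smooth_on S f \<longleftrightarrow> (\<forall>r. cont_diff_on r S f)"

definition grad :: "(real^'m \<Rightarrow> real) \<Rightarrow> real^'m \<Rightarrow> real^'m" where
  "grad f u = (\<chi> i. frechet_derivative f (at u) (axis i 1))"

definition hess :: "(real^'m \<Rightarrow> real) \<Rightarrow> real^'m \<Rightarrow> real^'m^'m" where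
  "hess f u = jacobian (grad f) (at u)"

definition partial :: "'d \<Rightarrow> (real^'d \<Rightarrow> 'b::real_normed_vector) \<Rightarrow> real^'d \<Rightarrow> 'b" where
  "partial k f x = frechet_derivative f (at x) (axis k 1)"

definition spd :: "real^'a^'a \<Rightarrow> bool" where
  "spd M \<longleftrightarrow> transpose M = M \<and> (\<forall>v. v \<noteq> 0 \<longrightarrow> 0 < v \<bullet> (M *v v))"

definition skw :: "real^'a^'a \<Rightarrow> real^'a^'a" where
  "skw X = (1/2) *\<^sub>R (X - transpose X)"

definition outer :: "real^'a \<Rightarrow> real^'b \<Rightarrow> real^'b^'a" where
  "outer v w = (\<chi> i j. v $ i * w $ j)"

text \<open>The entries of a coefficient vector are indexed by pairs: (basis function, component of the
  system). They are ordered lexicographically, i.e. one block of size m per basis function. The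
  order is spelled out because the order of the library on pairs is the componentwise one.\<close>

definition lex_less :: "'n::linorder \<times> 'm::linorder \<Rightarrow> 'n \<times> 'm \<Rightarrow> bool" where
  "lex_less a b \<longleftrightarrow> fst a < fst b \<or> fst a = fst b \<and> snd a < snd b"

definition cholesky_factor ::
  "real^('n::{finite,linorder} \<times> 'm::{finite,linorder})^('n \<times> 'm) \<Rightarrow> real^('n \<times> 'm)^('n \<times> 'm) \<Rightarrow> bool" where
  "cholesky_factor M R \<longleftrightarrow>
     M = transpose R ** R \<and> (\<forall>a b. lex_less b a \<longrightarrow> R $ a $ b = 0) \<and> (\<forall>a. 0 < R $ a $ a)"

definition orth :: "real^'a^'a \<Rightarrow> real^'a^'a \<Rightarrow> real^'a^'a" where
  "orth R X = matrix_inv (transpose R) ** X ** matrix_inv R"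


section \<open>Polynomials and quadrature\<close>

text \<open>Polynomial functions of total degree at most q.\<close>

definition Vpoly :: "nat \<Rightarrow> (real^'d \<Rightarrow> real) set" where
  "Vpoly q = {f. \<exists>c. f = (\<lambda>x. \<Sum>a | sum a UNIV \<le> q. c (a :: 'd \<Rightarrow> nat) * (\<Prod>i\<in>UNIV. x $ i ^ a i))}"

record 'a quadrature =
  nodes :: "'a set"
  weight :: "'a \<Rightarrow> real"

definition qsum :: "'a quadrature \<Rightarrow> ('a \<Rightarrow> 'b::real_vector) \<Rightarrow> 'b" where
  "qsum Q f = (\<Sum>x\<in>nodes Q. weight Q x *\<^sub>R f x)"

text \<open>Positive-weight quadrature with nodes in S that integrates polynomials of degree at most r
  exactly over S with respect to the measure \<mu>.\<close>

definition exact_quadrature ::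
  "(real^'d) measure \<Rightarrow> (real^'d) set \<Rightarrow> nat \<Rightarrow> (real^'d) quadrature \<Rightarrow> bool" where
  "exact_quadrature \<mu> S r Q \<longleftrightarrow>
     finite (nodes Q) \<and> nodes Q \<subseteq> S \<and> (\<forall>x\<in>nodes Q. 0 < weight Q x) \<and>
     (\<forall>f\<in>Vpoly r. qsum Q f = (LINT x:S|\<mu>. f x))"

text \<open>Discrete L2 projection onto the polynomials of degree at most q: the polynomial solving the
  discrete normal equations. A solution exists since the weights are positive; it is unique if the
  discrete inner product is definite there, for instance if Q is exact to degree 2q.\<close>

definition dproj :: "(real^'d) quadrature \<Rightarrow> nat \<Rightarrow> (real^'d \<Rightarrow> real) \<Rightarrow> real^'d \<Rightarrow> real" where
  "dproj Q q f = (SOME y. y \<in> Vpoly q \<and>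
     (\<forall>\<psi>\<in>Vpoly q. qsum Q (\<lambda>x. y x * \<psi> x) = qsum Q (\<lambda>x. f x * \<psi> x)))"

text \<open>For a unit vector \<nu>: the (d-1)-dimensional Lebesgue measure of the hyperplane
  \<nu> \<bullet> x = b, obtained by projecting the Lebesgue measure of an adjacent slab of unit thickness
  orthogonally onto the hyperplane. For d = 1 it is the unit point mass.\<close>

definition hyperplane_measure :: "real^'d \<Rightarrow> real \<Rightarrow> (real^'d) measure" where
  "hyperplane_measure \<nu> b =
     distr (restrict_space lborel {x. 0 \<le> \<nu> \<bullet> x - b \<and> \<nu> \<bullet> x - b \<le> 1}) borel
       (\<lambda>x. x - (\<nu> \<bullet> x - b) *\<^sub>R \<nu>)"


section \<open>The system and its energy\<close>

record ('m, 'd) system =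
  adm :: "(real^'m) set"
  flux :: "'d \<Rightarrow> real^'m \<Rightarrow> real^'m"
  energy :: "real^'m \<Rightarrow> real"
  eflux :: "'d \<Rightarrow> real^'m \<Rightarrow> real"
  Gmat :: "'d \<Rightarrow> real^'m \<Rightarrow> real^'m^'m"

definition Amat :: "('m::finite, 'd) system \<Rightarrow> 'd \<Rightarrow> real^'m \<Rightarrow> real^'m^'m" where
  "Amat P k u = jacobian (flux P k) (at u)"

definition Hmat :: "('m::finite, 'd) system \<Rightarrow> real^'m \<Rightarrow> real^'m^'m" where
  "Hmat P u = (2 * energy P u / (u \<bullet> (hess (energy P) u *v u))) *\<^sub>R hess (energy P) u"

text \<open>The solution \<Delta>A of G = H (A + \<Delta>A).\<close>

definition DAmat :: "('m::finite, 'd) system \<Rightarrow> 'd \<Rightarrow> real^'m \<Rightarrow> real^'m^'m" where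
  "DAmat P k u = matrix_inv (Hmat P u) ** Gmat P k u - Amat P k u"

text \<open>The spectral bound excludes u = 0 from the admissible set: there the quotient
  in the definition of H is 0 by convention, so H would have the eigenvalue 0.\<close>

locale energy_system =
  fixes P :: "('m::finite, 'd::finite) system" and cH CH :: real
  assumes open_adm: "open (adm P)"
    and smooth_flux: "smooth_on (adm P) (flux P k)"
    and smooth_energy: "smooth_on (adm P) (energy P)"
    and smooth_eflux: "smooth_on (adm P) (eflux P k)"
    and compatible: "u \<in> adm P \<Longrightarrow> grad (energy P) u v* Amat P k u = grad (eflux P k) u"
    and energy_pos: "u \<in> adm P \<Longrightarrow> 0 < energy P u"
    and hess_spd: "u \<in> adm P \<Longrightarrow> spd (hess (energy P) u)"
    and bounds: "0 < cH" "cH \<le> CH"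
    and H_eigenvalues:
      "\<lbrakk>u \<in> adm P; v \<noteq> 0; Hmat P u *v v = r *\<^sub>R v\<rbrakk> \<Longrightarrow> cH \<le> r \<and> r \<le> CH"
    and smooth_G: "smooth_on (adm P) (Gmat P k)"
    and sym_G: "u \<in> adm P \<Longrightarrow> transpose (Gmat P k u) = Gmat P k u"
    and eflux_G: "u \<in> adm P \<Longrightarrow> eflux P k u = 1/2 * (u \<bullet> (Gmat P k u *v u))"


section \<open>The discretization\<close>

text \<open>Data of one element: \<^term>\<open>face D f\<close> lies in the hyperplane with unit normal
  \<^term>\<open>normal D f\<close> and offset \<^term>\<open>offset D f\<close>.\<close>

record ('d, 'f, 'n) element =
  dom :: "(real^'d) set"
  face :: "'f \<Rightarrow> (real^'d) set"
  normal :: "'f \<Rightarrow> real^'d"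
  offset :: "'f \<Rightarrow> real"
  deg :: nat
  basis :: "'n \<Rightarrow> real^'d \<Rightarrow> real"
  Qvol :: "(real^'d) quadrature"
  Qface :: "'f \<Rightarrow> (real^'d) quadrature"
  Qhi :: "(real^'d) quadrature"

definition face_measure :: "('d::finite, 'f, 'n) element \<Rightarrow> 'f \<Rightarrow> (real^'d) measure" where
  "face_measure D f = hyperplane_measure (normal D f) (offset D f)"

text \<open>The element is a compact, flat-faced (not necessarily convex) region. Two faces meet in a set
  of surface measure zero, and the normal points outwards at every point that belongs to a single
  face. The number n is the exactness degree of the high-order volume quadrature.\<close>

locale cpg_element =
  fixes D :: "('d::finite, 'f::finite, 'n::finite) element" and n :: nat
  assumes compact_dom: "compact (dom D)"
    and interior_dom: "interior (dom D) \<noteq> {}"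
    and unit_normal: "norm (normal D f) = 1"
    and closed_face: "closed (face D f)"
    and flat_face: "face D f \<subseteq> {x. normal D f \<bullet> x = offset D f}"
    and boundary: "frontier (dom D) = (\<Union>f. face D f)"
    and face_overlap: "f \<noteq> f' \<Longrightarrow> face D f \<inter> face D f' \<in> null_sets (face_measure D f)"
    and outward: "\<lbrakk>x \<in> face D f; \<And>f'. f' \<noteq> f \<Longrightarrow> x \<notin> face D f'\<rbrakk> \<Longrightarrow>
        \<exists>\<epsilon>>0. \<forall>s. 0 < s \<and> s < \<epsilon> \<longrightarrow>
          x - s *\<^sub>R normal D f \<in> dom D \<and> x + s *\<^sub>R normal D f \<notin> dom D"
    and basis_in: "basis D \<alpha> \<in> Vpoly (deg D)"
    and basis_span: "\<psi> \<in> Vpoly (deg D) \<Longrightarrow> \<exists>c. \<psi> = (\<lambda>x. \<Sum>\<alpha>\<in>UNIV. c \<alpha> * basis D \<alpha> x)"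
    and basis_orthonormal:
      "(LINT x:dom D|lborel. basis D \<alpha> x * basis D \<beta> x) = (if \<alpha> = \<beta> then 1 else 0)"
    and Qvol_exact: "exact_quadrature lborel (dom D) (3 * deg D) (Qvol D)"
    and Qface_exact: "exact_quadrature (face_measure D f) (face D f) (3 * deg D + 1) (Qface D f)"
    and Qhi_exact: "exact_quadrature lborel (dom D) n (Qhi D)"
    and hi_degree: "3 * deg D + 1 \<le> n"

definition Phi :: "('d::finite, 'f, 'n::finite) element \<Rightarrow> real^'d \<Rightarrow> real^('n \<times> 'm::finite)^'m" where
  "Phi D x = (\<chi> i a. if i = snd a then basis D (fst a) x else 0)"

definition u_p :: "('d::finite, 'f, 'n::finite) element \<Rightarrow> real^('n \<times> 'm::finite) \<Rightarrow> real^'d \<Rightarrow> real^'m" where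
  "u_p D U x = Phi D x *v U"

definition Yproj :: "('m::finite, 'd::finite) system \<Rightarrow> ('d, 'f, 'n::finite) element \<Rightarrow>
    ('d \<Rightarrow> real^'m \<Rightarrow> real^'m^'m) \<Rightarrow> real^('n \<times> 'm) \<Rightarrow> 'd \<Rightarrow> real^'d \<Rightarrow> real^'m^'m" where
  "Yproj P D X U k x = (\<chi> i j.
     dproj (Qhi D) (deg D + 1) (\<lambda>z. (Hmat P (u_p D U z) ** X k (u_p D U z)) $ i $ j) x)"

definition mass_op :: "('m::finite, 'd::finite) system \<Rightarrow> ('d, 'f, 'n::finite) element \<Rightarrow>
    real^('n \<times> 'm) \<Rightarrow> real^('n \<times> 'm)^('n \<times> 'm)" where
  "mass_op P D U = qsum (Qvol D) (\<lambda>x. transpose (Phi D x) ** Hmat P (u_p D U x) ** Phi D x)"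

definition N_op :: "('m::finite, 'd::finite) system \<Rightarrow> ('d, 'f, 'n::finite) element \<Rightarrow>
    real^('n \<times> 'm) \<Rightarrow> real^('n \<times> 'm)^('n \<times> 'm)" where
  "N_op P D U = qsum (Qvol D) (\<lambda>x. \<Sum>k\<in>UNIV.
     transpose (Phi D x) ** Yproj P D (Amat P) U k x ** partial k (Phi D) x)"

definition V_op :: "('m::finite, 'd::finite) system \<Rightarrow> ('d, 'f, 'n::finite) element \<Rightarrow>
    real^('n \<times> 'm) \<Rightarrow> real^('n \<times> 'm)^('n \<times> 'm)" where
  "V_op P D U = qsum (Qvol D) (\<lambda>x. \<Sum>k\<in>UNIV.
     transpose (Phi D x) ** partial k (Yproj P D (Amat P) U k) x ** Phi D x)"

definition bdry_op :: "('m::finite, 'd::finite) system \<Rightarrow> ('d, 'f::finite, 'n::finite) element \<Rightarrow>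
    ('d \<Rightarrow> real^'m \<Rightarrow> real^'m^'m) \<Rightarrow> real^('n \<times> 'm) \<Rightarrow> real^('n \<times> 'm)^('n \<times> 'm)" where
  "bdry_op P D X U = (\<Sum>f\<in>UNIV. qsum (Qface D f) (\<lambda>x. \<Sum>k\<in>UNIV.
     normal D f $ k *\<^sub>R (transpose (Phi D x) ** Yproj P D X U k x ** Phi D x)))"

definition B_op :: "('m::finite, 'd::finite) system \<Rightarrow> ('d, 'f::finite, 'n::finite) element \<Rightarrow>
    real^('n \<times> 'm) \<Rightarrow> real^('n \<times> 'm)^('n \<times> 'm)" where
  "B_op P D U = bdry_op P D (Amat P) U"

definition BD_op :: "('m::finite, 'd::finite) system \<Rightarrow> ('d, 'f::finite, 'n::finite) element \<Rightarrow>
    real^('n \<times> 'm) \<Rightarrow> real^('n \<times> 'm)^('n \<times> 'm)" where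
  "BD_op P D U = bdry_op P D (DAmat P) U"

definition mass_dot :: "('m::finite, 'd::finite) system \<Rightarrow> ('d, 'f, 'n::finite) element \<Rightarrow>
    (real \<Rightarrow> real^('n \<times> 'm)) \<Rightarrow> real \<Rightarrow> real^('n \<times> 'm)^('n \<times> 'm)" where
  "mass_dot P D U t = qsum (Qvol D) (\<lambda>x. transpose (Phi D x) **
     frechet_derivative (Hmat P) (at (u_p D (U t) x)) (vector_derivative (\<lambda>s. u_p D (U s) x) (at t)) **
     Phi D x)"

definition mass_dir :: "('m::finite, 'd::finite) system \<Rightarrow> ('d, 'f, 'n::finite) element \<Rightarrow>
    real^('n \<times> 'm) \<Rightarrow> real^('n \<times> 'm) \<Rightarrow> real^('n \<times> 'm)^('n \<times> 'm)" where
  "mass_dir P D U V = qsum (Qvol D) (\<lambda>x. transpose (Phi D x) **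
     frechet_derivative (Hmat P) (at (u_p D U x)) (Phi D x *v V) ** Phi D x)"

definition L_fun :: "('m::finite, 'd::finite) system \<Rightarrow> ('d, 'f, 'n::finite) element \<Rightarrow>
    real^('n \<times> 'm) \<Rightarrow> real^('n \<times> 'm) \<Rightarrow> real" where
  "L_fun P D U V = (U \<bullet> (mass_dir P D U V *v U)) / (2 * (U \<bullet> (mass_op P D U *v U)))"


section \<open>The closure\<close>

text \<open>Here w is the orthogonalized coefficient vector and C the operator that the closure corrects.\<close>

definition L_closure :: "real^'a \<Rightarrow> real^'a^'a \<Rightarrow> real^'a^'a" where
  "L_closure w C = ((w \<bullet> (C *v w)) / norm w ^ 4) *\<^sub>R outer w w"

definition C_EC :: "real^'a \<Rightarrow> real^'a^'a \<Rightarrow> real^'a^'a" where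
  "C_EC w C = C - L_closure w C"

definition K_EC :: "real^'a \<Rightarrow> real^'a^'a \<Rightarrow> real^'a^'a" where
  "K_EC w C = (1 / norm w ^ 2) *\<^sub>R (C_EC w C ** outer w w - outer w w ** C_EC w C)"

end

theory Submission
  imports Defs
begin

text \<open>The closure acts tangentially to the sphere through the orthogonalized state w = R U.
\<^item> The closed operator is C without the value of its quadratic form at w, so the wedge
  K applied to w returns C w minus the multiple of w that carries the Rayleigh quotient of C at w
  (\<open>K_EC_vector\<close>).
\<^item> Differentiating M = transpose R ** R along the trajectory and conjugating by R turns the
  derivative of the mass matrix into S + transpose S. Hence the half of it that sits in C restores the
  symmetric part of S, which the skew part of S misses, and the equation contains the full S w. Since
  the derivative of R U is R times the derivative of U, plus S w, the terms with S cancel.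
\<^item> The part of the Rayleigh quotient that comes from the mass matrix is the functional
  \<open>L_fun\<close> at the derivative of U, because both sides are the quotient of the same quadratic
  forms in the coordinates w and in the coordinates U. The rest of the Rayleigh quotient is \<gamma>.
\<^item> What remains is that half of V plus half of B minus the skew part of N is B - N. This is the
  discrete integration by parts N + transpose N + V = B (\<open>summation_by_parts\<close>).

The algebra rests on two facts with analytic content.

Integration by parts holds because all integrands are polynomials that the quadratures integrate
exactly, so that it reduces to the divergence theorem on the element, applied to the product of two
basis functions and one entry of Y. Collecting the terms of the product rule into transpose N needs Y to
be symmetric. It is, since H is a multiple of the Hessian of the energy and the compatibility
relation, differentiated once more, shows that the Hessian symmetrizes the flux Jacobians
(\<open>hess_Amat_symmetric\<close>).
The divergence theorem for a possibly nonconvex region with flat faces (\<open>divergence_theorem\<close>)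
is proved by integrating along the lines parallel to a coordinate axis. Almost every such line
crosses finitely many faces, each one transversally and away from the other faces, and on it the
statement is the fundamental theorem of calculus. The face integrals reappear because projecting a
unit slab along the axis onto a face scales its surface measure by the modulus of the normal component
(\<open>distr_oblique_projection\<close>).

The Cholesky factor has to be differentiable for S to have its meaning. The row-by-row Cholesky
recursion expresses each row through M and the earlier rows by sums, products, quotients with nonzero
denominator and square roots of positive numbers (\<open>cholesky_factor_differentiable\<close>), and M
is differentiable along the trajectory since H is differentiable on the admissible set.\<close>

section \<open>Slabs and their projections onto hyperplanes\<close>

lemma nn_integral_translate:
  fixes a :: "'a::euclidean_space"
  assumes [measurable]: "h \<in> borel_measurable borel"
  shows "(\<integral>\<^sup>+x. h (a + x) \<partial>lborel) = (\<integral>\<^sup>+x. h x \<partial>lborel)"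
proof -
  have "(\<integral>\<^sup>+x. h x \<partial>lborel) = (\<integral>\<^sup>+x. h x \<partial>distr lborel borel ((+) a))"
    by (subst lborel_distr_plus) simp
  also have "\<dots> = (\<integral>\<^sup>+x. h (a + x) \<partial>lborel)"
    by (subst nn_integral_distr) auto
  finally show ?thesis by simp
qed

text \<open>This is the uniqueness of translation-invariant measures, applied to the Lebesgue measure and its
image under T: the double integral of f x * g (x + T y) is evaluated in both orders of integration.\<close>

lemma nn_integral_linear_image_scaling:
  fixes T :: "'a::euclidean_space \<Rightarrow> 'a" and f g :: "'a \<Rightarrow> ennreal"
  assumes T: "linear T" "surj T"
    and [measurable]: "f \<in> borel_measurable borel" "g \<in> borel_measurable borel"
    and even: "\<And>x. f (- x) = f x"
  shows "(\<integral>\<^sup>+x. f x \<partial>lborel) * (\<integral>\<^sup>+y. g (T y) \<partial>lborel) = (\<integral>\<^sup>+x. g x \<partial>lborel) * (\<integral>\<^sup>+y. f (T y) \<partial>lborel)"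
proof -
  have mT[measurable]: "T \<in> borel_measurable borel"
    by (intro borel_measurable_continuous_onI linear_continuous_on linear_conv_bounded_linear[THEN iffD1] T)
  have inv: "(\<integral>\<^sup>+y. h (a + T y) \<partial>lborel) = (\<integral>\<^sup>+y. h (T y) \<partial>lborel)"
    if [measurable]: "h \<in> borel_measurable borel" for a and h :: "'a \<Rightarrow> ennreal"
  proof -
    obtain c where "T c = a" using T(2) by (metis surjD)
    then have "(\<lambda>y. h (a + T y)) = (\<lambda>y. h (T (c + y)))" using T(1) by (simp add: linear_add)
    then show ?thesis using nn_integral_translate[of "\<lambda>y. h (T y)" c] by simp
  qed
  have "(\<integral>\<^sup>+x. f x \<partial>lborel) * (\<integral>\<^sup>+y. g (T y) \<partial>lborel) = (\<integral>\<^sup>+x. (\<integral>\<^sup>+y. f x * g (x + T y) \<partial>lborel) \<partial>lborel)"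
    by (simp add: nn_integral_cmult nn_integral_multc inv)
  also have "\<dots> = (\<integral>\<^sup>+y. (\<integral>\<^sup>+x. f x * g (x + T y) \<partial>lborel) \<partial>lborel)"
    by (rule lborel_pair.Fubini') measurable
  also have "\<dots> = (\<integral>\<^sup>+y. (\<integral>\<^sup>+x. f (- (- x + T y)) * g x \<partial>lborel) \<partial>lborel)"
  proof (rule nn_integral_cong)
    fix y
    show "(\<integral>\<^sup>+x. f x * g (x + T y) \<partial>lborel) = (\<integral>\<^sup>+x. f (- (- x + T y)) * g x \<partial>lborel)"
      using nn_integral_translate[of "\<lambda>x. f x * g (x + T y)" "- T y"] by (simp add: algebra_simps)
  qed
  also have "\<dots> = (\<integral>\<^sup>+x. (\<integral>\<^sup>+y. f (- x + T y) * g x \<partial>lborel) \<partial>lborel)"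
    unfolding even by (rule lborel_pair.Fubini') measurable
  also have "\<dots> = (\<integral>\<^sup>+x. (\<integral>\<^sup>+y. f (T y) \<partial>lborel) * g x \<partial>lborel)"
    by (subst nn_integral_multc, measurable) (subst inv, measurable)
  also have "\<dots> = (\<integral>\<^sup>+x. g x \<partial>lborel) * (\<integral>\<^sup>+y. f (T y) \<partial>lborel)"
    by (subst nn_integral_cmult) (simp_all add: mult.commute)
  finally show ?thesis .
qed

lemma ennreal_square_cancel:
  fixes a b :: ennreal
  assumes "a * a = b * b" shows "a = b"
proof (cases a; cases b)
  fix x y :: real assume *: "a = ennreal x" "0 \<le> x" "b = ennreal y" "0 \<le> y"
  then have "ennreal (x * x) = ennreal (y * y)" using assms by (simp add: ennreal_mult)
  then have "x * x = y * y" using * by (subst (asm) ennreal_inj) auto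
  then show ?thesis using * by (simp add: power2_eq_square[symmetric])
qed (use assms in \<open>auto simp: ennreal_mult[symmetric]\<close>)

text \<open>By the uniqueness argument a shear T can only rescale the Lebesgue measure. The scale is 1
because T is conjugate to its own inverse by the reflection r in the hyperplane orthogonal to \<nu>.
A ball is invariant under r, so r preserves the measure, and therefore T and its inverse rescale it by
the same factor.\<close>

lemma nn_integral_shear:
  fixes \<nu> w :: "'a::euclidean_space"
  assumes "norm \<nu> = 1" "\<nu> \<bullet> w = 0" and [measurable]: "h \<in> borel_measurable borel"
  shows "(\<integral>\<^sup>+x. h (x + (\<nu> \<bullet> x - b) *\<^sub>R w) \<partial>lborel) = (\<integral>\<^sup>+x. h x \<partial>lborel)"
proof -
  define T where "T = (\<lambda>x. x + (\<nu> \<bullet> x) *\<^sub>R w)"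
  define r where "r = (\<lambda>x. x - (2 * (\<nu> \<bullet> x)) *\<^sub>R \<nu>)"
  have nn: "\<nu> \<bullet> \<nu> = 1" using assms(1) by (simp add: dot_square_norm)
  have lT: "linear T" and lr: "linear r"
    unfolding T_def r_def by (auto intro!: linearI simp: inner_right_distrib algebra_simps)
  have [measurable]: "T \<in> borel_measurable borel" "r \<in> borel_measurable borel"
    unfolding T_def r_def by measurable
  have rr: "r (r x) = x" for x by (auto simp: r_def inner_diff_right nn algebra_simps)
  have TrTr: "T (r (T (r x))) = x" for x
    using assms(2) by (auto simp: r_def T_def inner_diff_right inner_add_right nn algebra_simps)
  have rTrT: "r (T (r (T x))) = x" for x
    by (metis TrTr rr)
  have surj: "surj T" "surj r" using TrTr rr by (metis surj_def)+
  define f :: "'a \<Rightarrow> ennreal" where "f = indicator (ball 0 1)"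
  have fm[measurable]: "f \<in> borel_measurable borel" unfolding f_def by (intro borel_measurable_indicator) auto
  have f_even: "f (- x) = f x" for x by (simp add: f_def indicator_def)
  have "norm (r x) = norm x" for x
    by (simp add: norm_eq_sqrt_inner r_def inner_diff_left inner_diff_right nn inner_commute algebra_simps)
  then have fr: "f (r x) = f x" for x by (simp add: f_def indicator_def)
  have a_fin: "(\<integral>\<^sup>+x. f x \<partial>lborel) < \<infinity>" unfolding f_def
    using emeasure_bounded_finite[of "ball (0::'a) 1"] by simp
  have a_pos: "(\<integral>\<^sup>+x. f x \<partial>lborel) \<noteq> 0" unfolding f_def
    using open_not_negligible[of "ball (0::'a) 1"]
    by (auto simp: negligible_iff_null_sets null_sets_completion_iff null_sets_def)
  have r_inv: "(\<integral>\<^sup>+x. g (r x) \<partial>lborel) = (\<integral>\<^sup>+x. g x \<partial>lborel)" if [measurable]: "g \<in> borel_measurable borel" for g :: "'a \<Rightarrow> ennreal"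
    using nn_integral_linear_image_scaling[OF lr surj(2) fm that f_even] a_fin a_pos
    by (auto simp: fr mult.commute ennreal_mult_cancel_left)
  \<comment> \<open>With a and b the integrals of f and f o T: since r T r is the inverse of T, applying the
    scaling rule to f o (r T r) gives a * a = b * b.\<close>
  have "(\<integral>\<^sup>+x. f (T x) \<partial>lborel) = (\<integral>\<^sup>+x. f x \<partial>lborel)"
  proof -
    let ?a = "\<integral>\<^sup>+x. f x \<partial>lborel" and ?b = "\<integral>\<^sup>+x. f (T x) \<partial>lborel"
    have "?a * (\<integral>\<^sup>+y. f (r (T (r (T y)))) \<partial>lborel) = (\<integral>\<^sup>+y. f (r (T (r y))) \<partial>lborel) * ?b"
      by (rule nn_integral_linear_image_scaling[OF lT surj(1)]) (auto simp: f_even)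
    moreover have "(\<integral>\<^sup>+y. f (r (T (r y))) \<partial>lborel) = ?b"
      using r_inv[of "\<lambda>y. f (T y)"] by (simp add: fr)
    ultimately have "?a * ?a = ?b * ?b" by (simp add: rTrT)
    then show ?thesis using ennreal_square_cancel by metis
  qed
  then have T_inv: "(\<integral>\<^sup>+x. g (T x) \<partial>lborel) = (\<integral>\<^sup>+x. g x \<partial>lborel)" if [measurable]: "g \<in> borel_measurable borel" for g :: "'a \<Rightarrow> ennreal"
    using nn_integral_linear_image_scaling[OF lT surj(1) fm that f_even] a_fin a_pos
    by (auto simp: mult.commute ennreal_mult_cancel_left)
  have "(\<integral>\<^sup>+x. h x \<partial>lborel) = (\<integral>\<^sup>+x. h (- b *\<^sub>R w + x) \<partial>lborel)"
    by (rule nn_integral_translate[symmetric]) measurable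
  also have "\<dots> = (\<integral>\<^sup>+x. h (- b *\<^sub>R w + T x) \<partial>lborel)"
    by (rule T_inv[symmetric]) measurable
  finally show ?thesis by (simp add: T_def algebra_simps)
qed

text \<open>For a function that is constant along the lines in direction v, only the total weight on each line
matters. This makes slabs that are cut off in different directions interchangeable.\<close>

lemma nn_integral_weight_exchange:
  fixes v :: "'a::euclidean_space" and \<theta> \<theta>' G :: "'a \<Rightarrow> ennreal"
  assumes [measurable]: "\<theta> \<in> borel_measurable borel" "\<theta>' \<in> borel_measurable borel" "G \<in> borel_measurable borel"
    and \<theta>: "\<And>x. (\<integral>\<^sup>+s. \<theta> (x + s *\<^sub>R v) \<partial>lborel) = 1"
    and \<theta>': "\<And>x. (\<integral>\<^sup>+s. \<theta>' (x + s *\<^sub>R v) \<partial>lborel) = 1"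
    and G: "\<And>x s. G (x + s *\<^sub>R v) = G x"
  shows "(\<integral>\<^sup>+x. \<theta> x * G x \<partial>lborel) = (\<integral>\<^sup>+x. \<theta>' x * G x \<partial>lborel)"
proof -
  have "(\<integral>\<^sup>+x. \<theta> x * G x \<partial>lborel) = (\<integral>\<^sup>+x. (\<integral>\<^sup>+s. \<theta> x * G x * \<theta>' (x + s *\<^sub>R v) \<partial>lborel) \<partial>lborel)"
    by (simp add: nn_integral_cmult \<theta>')
  also have "\<dots> = (\<integral>\<^sup>+s. (\<integral>\<^sup>+x. \<theta> x * G x * \<theta>' (x + s *\<^sub>R v) \<partial>lborel) \<partial>lborel)"
    by (rule lborel_pair.Fubini') measurable
  also have "\<dots> = (\<integral>\<^sup>+s. (\<integral>\<^sup>+y. \<theta> (y + (- s) *\<^sub>R v) * G y * \<theta>' y \<partial>lborel) \<partial>lborel)"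
  proof (rule nn_integral_cong)
    fix s :: real
    have "(\<integral>\<^sup>+x. \<theta> x * G x * \<theta>' (x + s *\<^sub>R v) \<partial>lborel) =
      (\<integral>\<^sup>+y. \<theta> ((- s) *\<^sub>R v + y) * G ((- s) *\<^sub>R v + y) * \<theta>' ((- s) *\<^sub>R v + y + s *\<^sub>R v) \<partial>lborel)"
      by (rule nn_integral_translate[symmetric]) measurable
    then show "(\<integral>\<^sup>+x. \<theta> x * G x * \<theta>' (x + s *\<^sub>R v) \<partial>lborel) =
      (\<integral>\<^sup>+y. \<theta> (y + (- s) *\<^sub>R v) * G y * \<theta>' y \<partial>lborel)"
      using G[of _ "-s"] by (simp add: add.commute)
  qed
  also have "\<dots> = (\<integral>\<^sup>+y. (\<integral>\<^sup>+s. \<theta> (y + (- s) *\<^sub>R v) * G y * \<theta>' y \<partial>lborel) \<partial>lborel)"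
    by (rule lborel_pair.Fubini') measurable
  also have "\<dots> = (\<integral>\<^sup>+y. \<theta>' y * G y \<partial>lborel)"
  proof (rule nn_integral_cong)
    fix y
    have "(\<integral>\<^sup>+s. \<theta> (y + (- s) *\<^sub>R v) \<partial>lborel) = (\<integral>\<^sup>+s. \<theta> (y + s *\<^sub>R v) \<partial>lborel)"
      using nn_integral_real_affine[of "\<lambda>s. \<theta> (y + s *\<^sub>R v)" "-1" 0] by simp
    then have *: "(\<integral>\<^sup>+s. \<theta> (y + (- s) *\<^sub>R v) \<partial>lborel) = 1" using \<theta> by simp
    have "(\<integral>\<^sup>+s. \<theta> (y + (- s) *\<^sub>R v) * G y * \<theta>' y \<partial>lborel) = (\<integral>\<^sup>+s. (\<theta>' y * G y) * \<theta> (y + (- s) *\<^sub>R v) \<partial>lborel)"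
      by (simp add: mult_ac)
    also have "\<dots> = \<theta>' y * G y"
      by (subst nn_integral_cmult) (use * in auto)
    finally show "(\<integral>\<^sup>+s. \<theta> (y + (- s) *\<^sub>R v) * G y * \<theta>' y \<partial>lborel) = \<theta>' y * G y" .
  qed
  finally show ?thesis .
qed

lemma nn_integral_hyperplane_measure:
  fixes \<nu> :: "real^'d::finite"
  assumes [measurable]: "G \<in> borel_measurable borel"
  shows "(\<integral>\<^sup>+y. G y \<partial>hyperplane_measure \<nu> b) =
    (\<integral>\<^sup>+x. indicator {x. 0 \<le> \<nu> \<bullet> x - b \<and> \<nu> \<bullet> x - b \<le> 1} x * G (x - (\<nu> \<bullet> x - b) *\<^sub>R \<nu>) \<partial>lborel)"
proof -
  have [measurable]: "{x. 0 \<le> \<nu> \<bullet> x - b \<and> \<nu> \<bullet> x - b \<le> 1} \<in> sets borel" by measurable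
  show ?thesis unfolding hyperplane_measure_def
    by (subst nn_integral_distr)
       (auto simp: nn_integral_restrict_space mult.commute intro!: measurable_restrict_space1)
qed

lemma indicator_interval_nn_integral:
  assumes "c \<noteq> 0"
  shows "(\<integral>\<^sup>+s. ennreal \<bar>c\<bar> * indicator {s. 0 \<le> a + c * s \<and> a + c * s \<le> 1} s \<partial>lborel) = (1::ennreal)"
proof -
  have "(\<integral>\<^sup>+s. indicator {0..1::real} s \<partial>lborel) =
     ennreal \<bar>c\<bar> * (\<integral>\<^sup>+s. indicator {0..1} (a + c * s) \<partial>lborel)"
    by (rule nn_integral_real_affine) (use assms in auto)
  moreover have "(\<integral>\<^sup>+s. ennreal \<bar>c\<bar> * indicator {s. 0 \<le> a + c * s \<and> a + c * s \<le> 1} s \<partial>lborel)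
     = ennreal \<bar>c\<bar> * (\<integral>\<^sup>+s. indicator {0..1} (a + c * s) \<partial>lborel)"
    by (subst nn_integral_cmult[symmetric]) (auto simp: indicator_def)
  ultimately show ?thesis by simp
qed

text \<open>The definition of the hyperplane measure projects a slab that is parallel to the hyperplane, along
the normal. Here the slab is bounded in a coordinate direction and projected along it. The weight
exchange replaces the slab, at the price of the factor, and a shear within the slab turns the oblique
projection into the orthogonal one.\<close>

lemma hyperplane_measure_oblique:
  fixes \<nu> :: "real^'d::finite"
  assumes \<nu>: "norm \<nu> = 1" and k: "\<nu> $ k \<noteq> 0" and [measurable]: "G \<in> borel_measurable borel"
  shows "(\<integral>\<^sup>+x. indicator {x. 0 \<le> x $ k \<and> x $ k \<le> 1} x * G (x - ((\<nu> \<bullet> x - b) / \<nu> $ k) *\<^sub>R axis k 1) \<partial>lborel) =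
    ennreal \<bar>\<nu> $ k\<bar> * (\<integral>\<^sup>+y. G y \<partial>hyperplane_measure \<nu> b)"
proof -
  define e :: "real^'d" where "e = axis k 1"
  define p where "p = (\<lambda>x. x - ((\<nu> \<bullet> x - b) / \<nu> $ k) *\<^sub>R e)"
  let ?S = "{x. 0 \<le> \<nu> \<bullet> x - b \<and> \<nu> \<bullet> x - b \<le> 1}"
  have \<nu>e: "\<nu> \<bullet> e = \<nu> $ k" by (simp add: e_def inner_axis)
  have [measurable]: "?S \<in> sets borel" by measurable
  have [measurable]: "{x::real^'d. 0 \<le> x $ k \<and> x $ k \<le> 1} \<in> sets borel" by measurable
  have [measurable]: "p \<in> borel_measurable borel" unfolding p_def by measurable
  have inv: "p (x + s *\<^sub>R e) = p x" for x s
    using k by (simp add: p_def inner_add_right \<nu>e add_divide_distrib diff_divide_distrib algebra_simps)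
  have "(\<integral>\<^sup>+x. indicator {x. 0 \<le> x $ k \<and> x $ k \<le> 1} x * G (p x) \<partial>lborel) =
    (\<integral>\<^sup>+x. (ennreal \<bar>\<nu> $ k\<bar> * indicator ?S x) * G (p x) \<partial>lborel)"
  proof (rule nn_integral_weight_exchange[where v=e])
    fix x :: "real^'d"
    have "(\<integral>\<^sup>+s. ennreal \<bar>1::real\<bar> * indicator {s. 0 \<le> x $ k + 1 * s \<and> x $ k + 1 * s \<le> 1} s \<partial>lborel) = 1"
      by (rule indicator_interval_nn_integral) simp
    then show "(\<integral>\<^sup>+s. indicator {x. 0 \<le> x $ k \<and> x $ k \<le> 1} (x + s *\<^sub>R e) \<partial>lborel) = 1"
      by (simp add: e_def indicator_def)
    show "(\<integral>\<^sup>+s. ennreal \<bar>\<nu> $ k\<bar> * indicator ?S (x + s *\<^sub>R e) \<partial>lborel) = 1"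
      using indicator_interval_nn_integral[OF k, of "\<nu> \<bullet> x - b"]
      by (simp add: indicator_def inner_add_right \<nu>e algebra_simps)
  qed (simp_all add: inv)
  also have "\<dots> = ennreal \<bar>\<nu> $ k\<bar> * (\<integral>\<^sup>+x. indicator ?S x * G (p x) \<partial>lborel)"
    by (subst nn_integral_cmult[symmetric]) (auto simp: mult.assoc)
  also have "(\<integral>\<^sup>+x. indicator ?S x * G (p x) \<partial>lborel) =
     (\<integral>\<^sup>+x. indicator ?S x * G (x - (\<nu> \<bullet> x - b) *\<^sub>R \<nu>) \<partial>lborel)"
  proof -
    \<comment> \<open>After the shear along w, the oblique projection of a point is what its orthogonal projection was
      before.\<close>
    define w where "w = (1 / \<nu> $ k) *\<^sub>R e - \<nu>"
    have nn: "\<nu> \<bullet> \<nu> = 1" using \<nu> by (simp add: dot_square_norm)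
    have w: "\<nu> \<bullet> w = 0" using k nn by (simp add: w_def inner_diff_right \<nu>e)
    have "(\<integral>\<^sup>+x. indicator ?S x * G (p x) \<partial>lborel) =
      (\<integral>\<^sup>+x. indicator ?S (x + (\<nu> \<bullet> x - b) *\<^sub>R w) * G (p (x + (\<nu> \<bullet> x - b) *\<^sub>R w)) \<partial>lborel)"
      by (rule nn_integral_shear[OF \<nu> w, symmetric]) measurable
    also have "\<dots> = (\<integral>\<^sup>+x. indicator ?S x * G (x - (\<nu> \<bullet> x - b) *\<^sub>R \<nu>) \<partial>lborel)"
    proof (rule nn_integral_cong)
      fix x
      have "p (x + (\<nu> \<bullet> x - b) *\<^sub>R w) = x - (\<nu> \<bullet> x - b) *\<^sub>R \<nu>"
        using w by (simp add: p_def inner_add_right) (simp add: w_def algebra_simps)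
      then show "indicator ?S (x + (\<nu> \<bullet> x - b) *\<^sub>R w) * G (p (x + (\<nu> \<bullet> x - b) *\<^sub>R w)) =
        indicator ?S x * G (x - (\<nu> \<bullet> x - b) *\<^sub>R \<nu>)"
        using w by (simp add: indicator_def inner_add_right)
    qed
    finally show ?thesis .
  qed
  also have "\<dots> = (\<integral>\<^sup>+y. G y \<partial>hyperplane_measure \<nu> b)"
    by (rule nn_integral_hyperplane_measure[symmetric]) measurable
  finally show ?thesis unfolding p_def e_def .
qed

lemma distr_oblique_projection:
  fixes \<nu> :: "real^'d::finite"
  assumes \<nu>: "norm \<nu> = 1" and k: "\<nu> $ k \<noteq> 0"
  shows "distr (restrict_space lborel {x. 0 \<le> x $ k \<and> x $ k \<le> 1}) borel
      (\<lambda>x. x - ((\<nu> \<bullet> x - b) / \<nu> $ k) *\<^sub>R axis k 1) =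
    density (hyperplane_measure \<nu> b) (\<lambda>_. ennreal \<bar>\<nu> $ k\<bar>)" (is "?L = ?R")
proof (rule measure_eqI)
  have sh: "sets (hyperplane_measure \<nu> b) = sets borel" by (simp add: hyperplane_measure_def)
  show "sets ?L = sets ?R" by (simp add: sh)
  have [measurable]: "{x::real^'d. 0 \<le> x $ k \<and> x $ k \<le> 1} \<in> sets borel" by measurable
  fix A assume "A \<in> sets ?L"
  then have A: "A \<in> sets borel" by simp
  then have [measurable]: "indicator A \<in> borel_measurable borel" by measurable
  have mp: "(\<lambda>x. x - ((\<nu> \<bullet> x - b) / \<nu> $ k) *\<^sub>R axis k 1) \<in> borel_measurable (restrict_space lborel {x. 0 \<le> x $ k \<and> x $ k \<le> 1})"
    by (rule measurable_restrict_space1) measurable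
  have "emeasure ?L A = (\<integral>\<^sup>+x. indicator A x \<partial>?L)" using A by simp
  also have "\<dots> = (\<integral>\<^sup>+x. indicator A (x - ((\<nu> \<bullet> x - b) / \<nu> $ k) *\<^sub>R axis k 1) \<partial>restrict_space lborel {x. 0 \<le> x $ k \<and> x $ k \<le> 1})"
    by (subst nn_integral_distr[OF mp]) (use A in auto)
  also have "\<dots> = (\<integral>\<^sup>+x. indicator {x. 0 \<le> x $ k \<and> x $ k \<le> 1} x * indicator A (x - ((\<nu> \<bullet> x - b) / \<nu> $ k) *\<^sub>R axis k 1) \<partial>lborel)"
    by (subst nn_integral_restrict_space) (auto simp: mult.commute)
  also have "\<dots> = ennreal \<bar>\<nu> $ k\<bar> * (\<integral>\<^sup>+y. indicator A y \<partial>hyperplane_measure \<nu> b)"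
    by (rule hyperplane_measure_oblique[OF assms]) measurable
  also have "\<dots> = emeasure ?R A"
    using A sh by (subst emeasure_density) (auto simp: nn_integral_cmult)
  finally show "emeasure ?L A = emeasure ?R A" .
qed

section \<open>Integration along lines\<close>

text \<open>A bounded set whose indicator only changes at the points g f, dropping there from 1 to 0 if c f = 1
and rising if c f = -1, is a signed sum of half-lines: the difference \<psi> of both sides has a limit
\<kappa> at every point, \<kappa> is locally constant, hence constant, and it vanishes far to the right.\<close>

lemma jump_representation:
  fixes L :: "real set" and g c :: "'f \<Rightarrow> real"
  assumes fin: "finite F" and bdd: "\<And>s. s \<in> L \<Longrightarrow> \<bar>s\<bar> \<le> N" and gN: "\<And>f. f \<in> F \<Longrightarrow> \<bar>g f\<bar> \<le> N"
    and inj: "inj_on g F"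
    and nohit: "\<And>s. s \<notin> g ` F \<Longrightarrow> \<forall>\<^sub>F r in at s. r \<in> L \<longleftrightarrow> s \<in> L"
    and hit: "\<And>f. f \<in> F \<Longrightarrow> \<forall>\<^sub>F r in at (g f). r \<in> L \<longleftrightarrow> c f * (r - g f) < 0"
    and sgn: "\<And>f. f \<in> F \<Longrightarrow> \<bar>c f\<bar> = 1"
    and s: "s \<notin> g ` F"
  shows "(indicator L s :: real) = (\<Sum>f\<in>F. c f * indicator {..<g f} s)"
proof -
  define \<psi> where "\<psi> = (\<lambda>s. (indicator L s :: real) - (\<Sum>f\<in>F. c f * indicator {..<g f} s))"
  have step: "\<forall>\<^sub>F r in at s. (indicator {..<b} r :: real) = indicator {..<b} s" if "s \<noteq> b" for s b :: real
  proof (cases "s < b")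
    case True
    then have "\<forall>\<^sub>F r in at s. r < b" by (rule order_tendstoD(2)[OF tendsto_ident_at])
    then show ?thesis by eventually_elim (use True in simp)
  next
    case False
    with that have "b < s" by simp
    then have "\<forall>\<^sub>F r in at s. b < r" by (rule order_tendstoD(1)[OF tendsto_ident_at])
    then show ?thesis by eventually_elim (use False in simp)
  qed
  have steps: "\<forall>\<^sub>F r in at s. (\<Sum>f\<in>E. c f * indicator {..<g f} r) = (\<Sum>f\<in>E. c f * indicator {..<g f} s)"
    if E: "E \<subseteq> F" "s \<notin> g ` E" for s E
  proof -
    have "finite E" using E(1) fin by (rule finite_subset)
    moreover have "\<forall>f\<in>E. \<forall>\<^sub>F r in at s. (indicator {..<g f} r :: real) = indicator {..<g f} s"
      using E(2) by (intro ballI step) blast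
    ultimately have "\<forall>\<^sub>F r in at s. \<forall>f\<in>E. (indicator {..<g f} r :: real) = indicator {..<g f} s"
      by (simp add: eventually_ball_finite)
    then show ?thesis
    proof eventually_elim
      case (elim r)
      then show ?case by (intro sum.cong) simp_all
    qed
  qed
  have off: "\<forall>\<^sub>F r in at s. \<psi> r = \<psi> s" if ns: "s \<notin> g ` F" for s
    using nohit[OF ns] steps[OF subset_refl ns]
  proof eventually_elim
    case (elim r)
    have "(indicator L r :: real) = indicator L s" using elim(1) by (simp add: indicator_def)
    then show ?case unfolding \<psi>_def elim(2) by (rule arg_cong2[where f=minus]) (rule refl)
  qed
  have "\<exists>k. \<forall>\<^sub>F r in at s. \<psi> r = k" for s
  proof (cases "s \<in> g ` F")
    case False
    then show ?thesis using off by blast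
  next
    case True
    then obtain f where f: "f \<in> F" "s = g f" by auto
    have ns: "s \<notin> g ` (F - {f})" using f inj by (auto simp: inj_on_def)
    have "\<forall>\<^sub>F r in at s. r \<noteq> s" by (simp add: eventually_at_filter)
    moreover have "\<forall>\<^sub>F r in at s. r \<in> L \<longleftrightarrow> c f * (r - s) < 0" using hit[OF f(1)] f(2) by simp
    moreover note steps[OF Diff_subset ns]
    ultimately have "\<forall>\<^sub>F r in at s. \<psi> r = (if c f > 0 then 0 else 1) - (\<Sum>f\<in>F - {f}. c f * indicator {..<g f} s)"
    proof eventually_elim
      case (elim r)
      have "(\<Sum>f\<in>F. c f * indicator {..<g f} r) = c f * indicator {..<g f} r + (\<Sum>f\<in>F - {f}. c f * indicator {..<g f} r)"
        using fin f(1) by (rule sum.remove)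
      moreover have "indicator L r - c f * indicator {..<g f} r = (if c f > 0 then 0 else 1)"
      proof (cases "c f > 0")
        case True
        then have "c f = 1" using sgn[OF f(1)] by simp
        then show ?thesis using elim(1,2) f(2) by (auto simp: indicator_def)
      next
        case False
        then have "c f = - 1" using sgn[OF f(1)] by simp
        then show ?thesis using elim(1,2) f(2) by (auto simp: indicator_def)
      qed
      ultimately show ?case using elim(3) by (simp add: \<psi>_def del: sum_mult_indicator)
    qed
    then show ?thesis by blast
  qed
  then obtain \<kappa> where \<kappa>: "\<And>s. \<forall>\<^sub>F r in at s. \<psi> r = \<kappa> s" by metis
  have uniq: "\<kappa> s = k" if "\<forall>\<^sub>F r in at s. \<psi> r = k" for s k
  proof -
    have "\<forall>\<^sub>F r in at s. \<kappa> s = k" using that \<kappa>[of s] by eventually_elim simp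
    then show ?thesis by simp
  qed
  have "\<kappa> constant_on UNIV"
  proof (rule locally_constant_imp_constant)
    fix a :: real
    obtain S where S: "open S" "a \<in> S" "\<And>r. r \<in> S \<Longrightarrow> r \<noteq> a \<Longrightarrow> \<psi> r = \<kappa> a"
      using \<kappa>[of a] unfolding eventually_at_topological by blast
    have "\<kappa> x = \<kappa> a" if x: "x \<in> S" for x
    proof (cases "x = a")
      case False
      have "\<forall>\<^sub>F r in at x. r \<in> S - {a}"
        using False x S(1) by (intro eventually_at_in_open' open_delete) auto
      then have "\<forall>\<^sub>F r in at x. \<psi> r = \<kappa> a" by eventually_elim (simp add: S(3))
      then show ?thesis by (rule uniq)
    qed simp
    then show "\<exists>T. openin (top_of_set UNIV) T \<and> a \<in> T \<and> (\<forall>x\<in>T. \<kappa> x = \<kappa> a)"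
      using S(1,2) by (metis open_openin subtopology_UNIV)
  qed simp
  then obtain k where k: "\<And>s. \<kappa> s = k" unfolding constant_on_def by blast
  have "\<kappa> (N + 1) = 0"
  proof (rule uniq)
    have "\<forall>\<^sub>F r in at (N + 1). N < r" by (rule order_tendstoD(1)[OF tendsto_ident_at]) simp
    then show "\<forall>\<^sub>F r in at (N + 1). \<psi> r = 0"
    proof eventually_elim
      case (elim r)
      then have "r \<notin> L" using bdd[of r] by auto
      moreover have "c f * indicator {..<g f} r = 0" if "f \<in> F" for f using gN[OF that] elim by (auto simp: indicator_def)
      then have "(\<Sum>f\<in>F. c f * indicator {..<g f} r) = 0" by (intro sum.neutral ballI)
      ultimately show ?case by (simp add: \<psi>_def del: sum_mult_indicator)
    qed
  qed
  moreover have "\<kappa> s = \<psi> s" using off[OF s] by (rule uniq)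
  ultimately have "\<psi> s = 0" using k by simp
  then show ?thesis by (simp add: \<psi>_def del: sum_mult_indicator)
qed

text \<open>The half-lines are cut off at a point to the left of everything. The values of \<phi> there cancel,
since the signs of all jumps add up to 0.\<close>

lemma jump_integral:
  fixes L :: "real set" and g c :: "'f \<Rightarrow> real" and \<phi> \<phi>' :: "real \<Rightarrow> real"
  assumes fin: "finite F" and bdd: "bounded L"
    and inj: "inj_on g F"
    and nohit: "\<And>s. s \<notin> g ` F \<Longrightarrow> \<forall>\<^sub>F r in at s. r \<in> L \<longleftrightarrow> s \<in> L"
    and hit: "\<And>f. f \<in> F \<Longrightarrow> \<forall>\<^sub>F r in at (g f). r \<in> L \<longleftrightarrow> c f * (r - g f) < 0"
    and sgn: "\<And>f. f \<in> F \<Longrightarrow> \<bar>c f\<bar> = 1"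
    and deriv: "\<And>s. (\<phi> has_real_derivative \<phi>' s) (at s)" and cont: "continuous_on UNIV \<phi>'"
    and L: "L \<in> sets borel"
  shows "(\<integral>s. indicator L s * \<phi>' s \<partial>lborel) = (\<Sum>f\<in>F. c f * \<phi> (g f))"
proof -
  obtain N where N: "\<And>s. s \<in> L \<Longrightarrow> \<bar>s\<bar> \<le> N" "\<And>f. f \<in> F \<Longrightarrow> \<bar>g f\<bar> \<le> N"
  proof -
    obtain a where "\<And>s. s \<in> L \<Longrightarrow> \<bar>s\<bar> \<le> a" using bdd by (auto simp: bounded_iff)
    moreover obtain b where "\<And>s. s \<in> g ` F \<Longrightarrow> \<bar>s\<bar> \<le> b"
      using finite_imp_bounded[of "g ` F"] fin by (auto simp: bounded_iff)
    ultimately show ?thesis by (intro that[of "max a b"]) (auto simp: le_max_iff_disj)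
  qed
  note rep = jump_representation[OF fin N inj nohit hit sgn, simplified]
  \<comment> \<open>To the left of everything the set is empty and all half-lines are present.\<close>
  have low: "- N - 1 \<notin> g ` F" using N(2) by force
  have "0 = (\<Sum>f\<in>F. c f * indicator {..<g f} (- N - 1))"
  proof -
    have "- N - 1 \<notin> L" using N(1)[of "- N - 1"] by auto
    then show ?thesis using rep[OF low] by simp
  qed
  also have "\<dots> = (\<Sum>f\<in>F. c f)"
    by (rule sum.cong) (use N(2) in \<open>force simp: indicator_def\<close>)+
  finally have c0: "(\<Sum>f\<in>F. c f) = 0" by simp
  have cf: "isCont \<phi>' s" for s using cont by (simp add: continuous_on_eq_continuous_at)
  have pm[measurable]: "\<phi>' \<in> borel_measurable borel" using cont by (rule borel_measurable_continuous_onI)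
  have hb: "has_bochner_integral lborel (\<lambda>s. \<phi>' s * indicator {- N - 1 .. g f} s) (\<phi> (g f) - \<phi> (- N - 1))" if "f \<in> F" for f
    by (rule has_bochner_integral_FTC_Icc_real) (use N(2)[OF that] deriv cf in auto)
  have "(\<integral>s. indicator L s * \<phi>' s \<partial>lborel) = (\<integral>s. (\<Sum>f\<in>F. c f * (\<phi>' s * indicator {- N - 1 .. g f} s)) \<partial>lborel)"
  proof (rule integral_cong_AE)
    have "g ` F \<in> null_sets lborel" using fin by (intro finite_imp_null_set_lborel) auto
    then have "AE s in lborel. s \<notin> g ` F" by (rule AE_not_in)
    then show "AE s in lborel. indicator L s * \<phi>' s = (\<Sum>f\<in>F. c f * (\<phi>' s * indicator {- N - 1 .. g f} s))"
    proof eventually_elim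
      case (elim s)
      show ?case
      proof (cases "s < - N - 1")
        case True
        then have "s \<notin> L" using N(1)[of s] by auto
        then show ?thesis using True by simp
      next
        case False
        have "(\<Sum>f\<in>F. c f * indicator {..<g f} s) = (\<Sum>f\<in>F. c f * indicator {- N - 1 .. g f} s)"
          by (rule sum.cong) (use False elim in \<open>auto simp: indicator_def\<close>)
        then show ?thesis using rep[OF elim] by (simp add: sum_distrib_left mult_ac)
      qed
    qed
  qed (use L in measurable)
  also have "\<dots> = (\<Sum>f\<in>F. c f * (\<phi> (g f) - \<phi> (- N - 1)))"
    by (intro has_bochner_integral_integral_eq has_bochner_integral_sum has_bochner_integral_mult_right hb)
  also have "\<dots> = (\<Sum>f\<in>F. c f * \<phi> (g f)) - (\<Sum>f\<in>F. c f) * \<phi> (- N - 1)"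
    by (simp add: algebra_simps sum_subtractf sum_distrib_left sum_distrib_right)
  finally show ?thesis using c0 by simp
qed

text \<open>The slab serves as a cross-section of unit thickness, so that the space of lines needs no measure of
its own. Translating along the axis recovers the integral over the whole set, because each line
meets the slab in a segment of length 1.\<close>

lemma integral_along_lines:
  fixes h :: "real^'d::finite \<Rightarrow> real"
  assumes \<Omega>: "compact \<Omega>" and h: "continuous_on UNIV h"
  shows "(\<integral>y. indicator \<Omega> y * h y \<partial>lborel) =
    (\<integral>x. indicator {x. 0 \<le> x $ k \<and> x $ k \<le> 1} x *
      (\<integral>s. indicator \<Omega> (x + s *\<^sub>R axis k 1) * h (x + s *\<^sub>R axis k 1) \<partial>lborel) \<partial>lborel)"
proof -
  define e :: "real^'d" where "e = axis k 1"
  define \<theta> :: "real^'d \<Rightarrow> real" where "\<theta> = indicator {x. 0 \<le> x $ k \<and> x $ k \<le> 1}"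
  have e1: "(x + s *\<^sub>R e) $ k = x $ k + s" for x s by (simp add: e_def)
  obtain B where B: "\<And>x. x \<in> \<Omega> \<Longrightarrow> norm x \<le> B" using compact_imp_bounded[OF \<Omega>] by (auto simp: bounded_iff)
  have h': "continuous_on S h" for S using h continuous_on_subset by blast
  have clo: "closed \<Omega>" using \<Omega> by (rule compact_imp_closed)
  have ce: "continuous_on UNIV (\<lambda>z::(real^'d)\<times>real. fst z + snd z *\<^sub>R e)" by (intro continuous_intros)
  have K1: "compact {z. 0 \<le> fst z $ k \<and> fst z $ k \<le> 1 \<and> fst z + snd z *\<^sub>R e \<in> \<Omega>}" (is "compact ?K1")
  proof (subst compact_eq_bounded_closed, intro conjI)
    have "closed ((\<lambda>z::(real^'d)\<times>real. fst z + snd z *\<^sub>R e) -` \<Omega>)"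
      using continuous_closed_preimage[OF ce closed_UNIV clo] by simp
    moreover have "closed {z::(real^'d)\<times>real. 0 \<le> fst z $ k \<and> fst z $ k \<le> 1}"
      by (intro closed_Collect_conj closed_Collect_le continuous_intros)
    ultimately have "closed ({z::(real^'d)\<times>real. 0 \<le> fst z $ k \<and> fst z $ k \<le> 1} \<inter> (\<lambda>z::(real^'d)\<times>real. fst z + snd z *\<^sub>R e) -` \<Omega>)"
      by (intro closed_Int)
    moreover have "{z::(real^'d)\<times>real. 0 \<le> fst z $ k \<and> fst z $ k \<le> 1} \<inter> (\<lambda>z::(real^'d)\<times>real. fst z + snd z *\<^sub>R e) -` \<Omega> = ?K1"
      by auto
    ultimately show "closed ?K1" by simp
    show "bounded ?K1" unfolding bounded_iff
    proof (intro exI ballI)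
      fix z assume z: "z \<in> ?K1"
      then have a: "norm (fst z + snd z *\<^sub>R e) \<le> B" using B by auto
      moreover have "\<bar>(fst z + snd z *\<^sub>R e) $ k\<bar> \<le> norm (fst z + snd z *\<^sub>R e)" by (rule component_le_norm_cart)
      ultimately have s: "\<bar>snd z\<bar> \<le> B + 1" using z unfolding e1 by auto
      have "norm (fst z) \<le> norm (fst z + snd z *\<^sub>R e) + norm (snd z *\<^sub>R e)"
        by (metis add_diff_cancel_right' norm_triangle_ineq4)
      also have "norm (snd z *\<^sub>R e) = \<bar>snd z\<bar>" by (simp add: e_def)
      finally have "norm (fst z) \<le> B + (B + 1)" using a s by linarith
      then show "norm z \<le> (B + (B + 1)) + (B + 1)"
        using norm_Pair_le[of "fst z" "snd z"] s by simp
    qed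
  qed
  \<comment> \<open>The same set in the coordinates (y, s) with y = x + s e, for the second use of Fubini.\<close>
  have K2: "compact {z. 0 \<le> (fst z + (- snd z) *\<^sub>R e) $ k \<and> (fst z + (- snd z) *\<^sub>R e) $ k \<le> 1 \<and> fst z \<in> \<Omega>}" (is "compact ?K2")
  proof -
    have "?K2 = (\<lambda>z. (fst z + snd z *\<^sub>R e, snd z)) ` ?K1"
    proof safe
      fix a b assume "0 \<le> (fst (a, b) + - snd (a, b) *\<^sub>R e) $ k" "(fst (a, b) + - snd (a, b) *\<^sub>R e) $ k \<le> 1" "fst (a, b) \<in> \<Omega>"
      then show "(a, b) \<in> (\<lambda>z. (fst z + snd z *\<^sub>R e, snd z)) ` ?K1"
        by (intro image_eqI[of _ _ "(a - b *\<^sub>R e, b)"]) auto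
    qed auto
    moreover have "compact ((\<lambda>z. (fst z + snd z *\<^sub>R e, snd z)) ` ?K1)"
      by (intro compact_continuous_image K1 continuous_intros)
    ultimately show ?thesis by simp
  qed
  have int1: "integrable (lborel \<Otimes>\<^sub>M lborel) (\<lambda>(x, s). \<theta> x * (indicator \<Omega> (x + s *\<^sub>R e) * h (x + s *\<^sub>R e)))"
  proof -
    have "integrable lborel (\<lambda>z. indicator ?K1 z *\<^sub>R h (fst z + snd z *\<^sub>R e))"
      by (intro borel_integrable_compact K1 continuous_on_compose2[OF h] continuous_intros) auto
    also have "(\<lambda>z. indicator ?K1 z *\<^sub>R h (fst z + snd z *\<^sub>R e)) = (\<lambda>(x, s). \<theta> x * (indicator \<Omega> (x + s *\<^sub>R e) * h (x + s *\<^sub>R e)))"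
      by (auto simp: fun_eq_iff \<theta>_def indicator_def)
    finally show ?thesis by (simp add: lborel_prod)
  qed
  have int2: "integrable (lborel \<Otimes>\<^sub>M lborel) (\<lambda>(y, s). \<theta> (y + (- s) *\<^sub>R e) * (indicator \<Omega> y * h y))"
  proof -
    have "integrable lborel (\<lambda>z. indicator ?K2 z *\<^sub>R h (fst z))"
      by (intro borel_integrable_compact K2 continuous_on_compose2[OF h] continuous_intros) auto
    also have "(\<lambda>z. indicator ?K2 z *\<^sub>R h (fst z)) = (\<lambda>(y, s). \<theta> (y + (- s) *\<^sub>R e) * (indicator \<Omega> y * h y))"
      by (auto simp: fun_eq_iff \<theta>_def indicator_def)
    finally show ?thesis by (simp add: lborel_prod)
  qed
  have [measurable]: "\<Omega> \<in> sets borel" "h \<in> borel_measurable borel" "\<theta> \<in> borel_measurable borel"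
    using clo h by (auto intro: borel_measurable_continuous_onI simp: \<theta>_def)
  have "(\<integral>x. \<theta> x * (\<integral>s. indicator \<Omega> (x + s *\<^sub>R e) * h (x + s *\<^sub>R e) \<partial>lborel) \<partial>lborel) =
    (\<integral>x. (\<integral>s. \<theta> x * (indicator \<Omega> (x + s *\<^sub>R e) * h (x + s *\<^sub>R e)) \<partial>lborel) \<partial>lborel)"
    by simp
  also have "\<dots> = (\<integral>s. (\<integral>x. \<theta> x * (indicator \<Omega> (x + s *\<^sub>R e) * h (x + s *\<^sub>R e)) \<partial>lborel) \<partial>lborel)"
    using lborel_pair.Fubini_integral[OF int1] by simp
  also have "\<dots> = (\<integral>s. (\<integral>y. \<theta> (y + (- s) *\<^sub>R e) * (indicator \<Omega> y * h y) \<partial>lborel) \<partial>lborel)"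
  proof (rule Bochner_Integration.integral_cong[OF refl])
    fix s :: real
    have "(\<integral>x. \<theta> x * (indicator \<Omega> (x + s *\<^sub>R e) * h (x + s *\<^sub>R e)) \<partial>lborel) =
      (\<integral>x. \<theta> x * (indicator \<Omega> (x + s *\<^sub>R e) * h (x + s *\<^sub>R e)) \<partial>distr lborel borel ((+) ((- s) *\<^sub>R e)))"
      by (subst lborel_distr_plus) simp
    also have "\<dots> = (\<integral>y. \<theta> ((- s) *\<^sub>R e + y) * (indicator \<Omega> ((- s) *\<^sub>R e + y + s *\<^sub>R e) * h ((- s) *\<^sub>R e + y + s *\<^sub>R e)) \<partial>lborel)"
      by (subst integral_distr) auto
    finally show "(\<integral>x. \<theta> x * (indicator \<Omega> (x + s *\<^sub>R e) * h (x + s *\<^sub>R e)) \<partial>lborel) =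
      (\<integral>y. \<theta> (y + (- s) *\<^sub>R e) * (indicator \<Omega> y * h y) \<partial>lborel)"
      by (simp add: add.commute)
  qed
  also have "\<dots> = (\<integral>y. (\<integral>s. \<theta> (y + (- s) *\<^sub>R e) * (indicator \<Omega> y * h y) \<partial>lborel) \<partial>lborel)"
    using lborel_pair.Fubini_integral[OF int2] by simp
  also have "\<dots> = (\<integral>y. indicator \<Omega> y * h y \<partial>lborel)"
  proof (rule Bochner_Integration.integral_cong[OF refl])
    fix y :: "real^'d"
    have "(\<integral>s. \<theta> (y + (- s) *\<^sub>R e) \<partial>lborel) = (\<integral>s. indicator {y $ k - 1 .. y $ k} s \<partial>lborel)"
      by (rule Bochner_Integration.integral_cong[OF refl]) (auto simp: \<theta>_def indicator_def e_def)
    also have "\<dots> = 1" by simp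
    finally show "(\<integral>s. \<theta> (y + (- s) *\<^sub>R e) * (indicator \<Omega> y * h y) \<partial>lborel) = indicator \<Omega> y * h y"
      by simp
  qed
  finally show ?thesis by (simp add: \<theta>_def e_def)
qed

context cpg_element
begin

section \<open>The divergence theorem on a flat-faced element\<close>

text \<open>Away from the other faces the boundary lies in one hyperplane. Each open half of a small ball is
connected and misses the boundary, so it lies on one side of it; the outward normal tells on which.\<close>

lemma half_balls_at_face:
  assumes y: "y \<in> face D f" and only: "\<And>f'. f' \<noteq> f \<Longrightarrow> y \<notin> face D f'"
  shows "\<exists>r>0. \<forall>z. dist z y < r \<longrightarrow> (normal D f \<bullet> z < offset D f \<longrightarrow> z \<in> dom D) \<and>
    (normal D f \<bullet> z > offset D f \<longrightarrow> z \<notin> dom D)"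
proof -
  let ?\<nu> = "normal D f" and ?b = "offset D f"
  have nn: "?\<nu> \<bullet> ?\<nu> = 1" using unit_normal[of f] by (simp add: dot_square_norm)
  have yb: "?\<nu> \<bullet> y = ?b" using flat_face[of f] y by auto
  have "closed (\<Union>f'\<in>UNIV - {f}. face D f')" using closed_face by (intro closed_UN) auto
  then have "open (- (\<Union>f'\<in>UNIV - {f}. face D f'))" by (rule open_Compl)
  moreover have "y \<in> - (\<Union>f'\<in>UNIV - {f}. face D f')" using only by auto
  ultimately have "\<exists>r>0. ball y r \<subseteq> - (\<Union>f'\<in>UNIV - {f}. face D f')"
    by (rule openE) metis
  then obtain r where r: "r > 0" "ball y r \<subseteq> - (\<Union>f'\<in>UNIV - {f}. face D f')"
    by (elim exE conjE)
  have fr: "?\<nu> \<bullet> z = ?b" if zf: "z \<in> frontier (dom D)" and zr: "z \<in> ball y r" for z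
  proof -
    obtain f' where f': "z \<in> face D f'" using zf boundary by auto
    have "f' = f" proof (rule ccontr)
      assume "f' \<noteq> f"
      then have "z \<in> (\<Union>f'\<in>UNIV - {f}. face D f')" using f' by auto
      then show False using r(2) zr by (meson ComplD subsetD)
    qed
    then show ?thesis using f' flat_face[of f] by auto
  qed
  obtain \<epsilon> where eps: "\<epsilon> > 0" "\<And>s. 0 < s \<Longrightarrow> s < \<epsilon> \<Longrightarrow> y - s *\<^sub>R ?\<nu> \<in> dom D \<and> y + s *\<^sub>R ?\<nu> \<notin> dom D"
    using outward[OF y only] by auto
  define s where "s = min (\<epsilon>/2) (r/2)"
  have s: "0 < s" "s < \<epsilon>" "s < r" using eps(1) r(1) by (auto simp: s_def)
  let ?lo = "ball y r \<inter> {z. ?\<nu> \<bullet> z < ?b}" and ?hi = "ball y r \<inter> {z. ?\<nu> \<bullet> z > ?b}"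
  have con: "connected ?lo" "connected ?hi"
    by (intro convex_connected convex_Int convex_ball convex_halfspace_lt convex_halfspace_gt)+
  have nofr: "?lo \<inter> frontier (dom D) = {}" "?hi \<inter> frontier (dom D) = {}"
    using fr by (force simp del: mem_ball)+
  have "y - s *\<^sub>R ?\<nu> \<in> ?lo \<inter> dom D" "y + s *\<^sub>R ?\<nu> \<in> ?hi - dom D"
    using s eps(2)[of s] yb unit_normal[of f] by (auto simp: dist_norm inner_diff_right inner_add_right nn)
  then have "?lo \<inter> dom D \<noteq> {}" "?hi - dom D \<noteq> {}" by blast+
  then have lo: "?lo - dom D = {}" and hi: "?hi \<inter> dom D = {}"
    using connected_Int_frontier[OF con(1), of "dom D"] connected_Int_frontier[OF con(2), of "dom D"] nofr by metis+
  show ?thesis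
  proof (intro exI[of _ r] conjI allI impI)
    fix z assume z: "dist z y < r"
    { assume "?\<nu> \<bullet> z < ?b"
      with z have "z \<in> ?lo" by (simp add: dist_commute)
      with lo show "z \<in> dom D" by blast }
    { assume "?\<nu> \<bullet> z > ?b"
      with z have "z \<in> ?hi" by (simp add: dist_commute)
      with hi show "z \<notin> dom D" by blast }
  qed (rule r(1))
qed

text \<open>The genericity that makes every crossing of a face by the line through x a jump of the indicator of
the element, in the direction that the normal of this face prescribes.\<close>

definition good_line :: "'d \<Rightarrow> real^'d \<Rightarrow> bool" where
  "good_line k x \<longleftrightarrow> (\<forall>f s. x + s *\<^sub>R axis k 1 \<in> face D f \<longrightarrow>
     normal D f $ k \<noteq> 0 \<and> (\<forall>f'. f' \<noteq> f \<longrightarrow> x + s *\<^sub>R axis k 1 \<notin> face D f'))"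

text \<open>The parameter at which the line through x meets the hyperplane of the face. If the line is parallel
to the face, the value is 0 by the convention for quotients and has no geometric meaning.\<close>

definition hit_time :: "'d \<Rightarrow> real^'d \<Rightarrow> 'f \<Rightarrow> real" where
  "hit_time k x f = (offset D f - normal D f \<bullet> x) / normal D f $ k"

lemma hit_time_unique:
  assumes "normal D f $ k \<noteq> 0" "x + s *\<^sub>R axis k 1 \<in> face D f"
  shows "s = hit_time k x f"
proof -
  have "normal D f \<bullet> (x + s *\<^sub>R axis k 1) = offset D f" using assms(2) flat_face[of f] by auto
  then show ?thesis using assms(1) by (simp add: hit_time_def inner_add_right inner_axis field_simps)
qed

lemma normal_at_line:
  assumes "normal D f $ k \<noteq> 0"
  shows "normal D f \<bullet> (x + r *\<^sub>R axis k 1) - offset D f = (r - hit_time k x f) * normal D f $ k"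
  using assms by (simp add: hit_time_def inner_add_right inner_axis field_simps)

lemma hit_time_projection:
  "x - ((normal D f \<bullet> x - offset D f) / normal D f $ k) *\<^sub>R axis k 1 = x + hit_time k x f *\<^sub>R axis k 1"
  by (simp add: hit_time_def vec_eq_iff diff_divide_distrib algebra_simps)

lemma distr_hit_point:
  assumes "normal D f $ k \<noteq> 0"
  shows "distr (restrict_space lborel {x. 0 \<le> x $ k \<and> x $ k \<le> 1}) borel (\<lambda>x. x + hit_time k x f *\<^sub>R axis k 1) =
    density (hyperplane_measure (normal D f) (offset D f)) (\<lambda>_. ennreal \<bar>normal D f $ k\<bar>)"
  unfolding hit_time_projection[symmetric] by (rule distr_oblique_projection[OF unit_normal assms])

text \<open>On a good line the element is a set whose boundary points are the crossings of the faces. A face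
is left in the direction of its normal, so the sign of the jump is the sign of the normal component.\<close>

lemma integral_along_good_line:
  fixes h h' :: "real^'d \<Rightarrow> real"
  assumes good: "good_line k x"
    and cont: "continuous_on UNIV h'"
    and deriv: "\<And>x. ((\<lambda>s. h (x + s *\<^sub>R axis k 1)) has_real_derivative h' x) (at 0)"
  shows "(\<integral>s. indicator (dom D) (x + s *\<^sub>R axis k 1) * h' (x + s *\<^sub>R axis k 1) \<partial>lborel) =
    (\<Sum>f | normal D f $ k \<noteq> 0. sgn (normal D f $ k) *
      (indicator (face D f) (x + hit_time k x f *\<^sub>R axis k 1) * h (x + hit_time k x f *\<^sub>R axis k 1)))"
proof -
  define line where "line = (\<lambda>s. x + s *\<^sub>R (axis k 1 :: real^'d))"
  define H where "H = {f. normal D f $ k \<noteq> 0 \<and> line (hit_time k x f) \<in> face D f}"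
  have lim: "(line \<longlongrightarrow> line s) (at s)" for s unfolding line_def by (intro tendsto_intros)
  have cline: "continuous_on UNIV line" unfolding line_def by (intro continuous_intros)
  have only: "line (hit_time k x f) \<notin> face D f'" if "f \<in> H" "f' \<noteq> f" for f f'
    using good that unfolding good_line_def H_def line_def by blast
  have L: "closed (line -` dom D)"
    using continuous_closed_preimage[OF cline closed_UNIV compact_imp_closed[OF compact_dom]] by simp
  have "(\<integral>s. indicator (line -` dom D) s * h' (line s) \<partial>lborel) = (\<Sum>f\<in>H. sgn (normal D f $ k) * h (line (hit_time k x f)))"
  proof (rule jump_integral[where g="hit_time k x" and \<phi>="\<lambda>s. h (line s)" and c="\<lambda>f. sgn (normal D f $ k)"])
    show "finite H" by simp
    obtain B where B: "\<And>y. y \<in> dom D \<Longrightarrow> norm y \<le> B"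
      using compact_imp_bounded[OF compact_dom] by (auto simp: bounded_iff)
    have "\<bar>s\<bar> \<le> B + \<bar>x $ k\<bar>" if "line s \<in> dom D" for s
    proof -
      have "\<bar>line s $ k\<bar> \<le> B" using B[OF that] component_le_norm_cart[of "line s" k] by linarith
      then show ?thesis by (simp add: line_def)
    qed
    then show "bounded (line -` dom D)" by (auto simp: bounded_iff)
    show "inj_on (hit_time k x) H"
    proof (rule inj_onI, rule ccontr)
      fix f f' assume *: "f \<in> H" "f' \<in> H" "hit_time k x f = hit_time k x f'" "f \<noteq> f'"
      then show False using only[of f f'] by (auto simp: H_def)
    qed
    show "\<forall>\<^sub>F r in at s. r \<in> line -` dom D \<longleftrightarrow> s \<in> line -` dom D" if s: "s \<notin> hit_time k x ` H" for s
    proof -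
      have "line s \<notin> face D f" for f
      proof
        assume f: "line s \<in> face D f"
        then have n: "normal D f $ k \<noteq> 0" using good by (auto simp: good_line_def line_def)
        then have "s = hit_time k x f" using f hit_time_unique by (simp add: line_def)
        then show False using s f n by (auto simp: H_def)
      qed
      then have nf: "line s \<notin> frontier (dom D)" using boundary by auto
      show ?thesis
      proof (cases "line s \<in> dom D")
        case True
        then have "line s \<in> interior (dom D)" using nf closure_subset by (auto simp: frontier_def)
        then have "\<forall>\<^sub>F r in at s. line r \<in> interior (dom D)" using lim open_interior by (rule topological_tendstoD[rotated 2])
        then show ?thesis by eventually_elim (use True interior_subset in auto)
      next
        case False
        have "open (- dom D)" using compact_imp_closed[OF compact_dom] by (rule open_Compl)
        then have "\<forall>\<^sub>F r in at s. line r \<in> - dom D" using lim False by (intro topological_tendstoD) auto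
        then show ?thesis by eventually_elim (use False in auto)
      qed
    qed
    show "\<forall>\<^sub>F r in at (hit_time k x f). r \<in> line -` dom D \<longleftrightarrow> sgn (normal D f $ k) * (r - hit_time k x f) < 0"
      if f: "f \<in> H" for f
    proof -
      let ?y = "line (hit_time k x f)"
      have n: "normal D f $ k \<noteq> 0" and y: "?y \<in> face D f" using f by (auto simp: H_def)
      obtain r0 where r0: "r0 > 0" "\<And>z. dist z ?y < r0 \<Longrightarrow> (normal D f \<bullet> z < offset D f \<longrightarrow> z \<in> dom D) \<and>
         (normal D f \<bullet> z > offset D f \<longrightarrow> z \<notin> dom D)"
        using half_balls_at_face[OF y only[OF f]] by blast
      have "\<forall>\<^sub>F r in at (hit_time k x f). dist (line r) ?y < r0" using lim r0(1) by (rule tendstoD)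
      moreover have "\<forall>\<^sub>F r in at (hit_time k x f). r \<noteq> hit_time k x f" by (simp add: eventually_at_filter)
      ultimately show ?thesis
      proof eventually_elim
        case (elim r)
        have eq: "normal D f \<bullet> line r - offset D f = (r - hit_time k x f) * normal D f $ k"
          unfolding line_def by (rule normal_at_line[OF n])
        have iff: "sgn (normal D f $ k) * (r - hit_time k x f) < 0 \<longleftrightarrow> (r - hit_time k x f) * normal D f $ k < 0"
          using n by (cases "normal D f $ k" "0::real" rule: linorder_cases) (auto simp: mult_less_0_iff)
        have "(r - hit_time k x f) * normal D f $ k \<noteq> 0" using n elim(2) by simp
        then consider "normal D f \<bullet> line r < offset D f" "(r - hit_time k x f) * normal D f $ k < 0"
          | "normal D f \<bullet> line r > offset D f" "\<not> (r - hit_time k x f) * normal D f $ k < 0"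
          using eq by linarith
        then show ?case using r0(2)[OF elim(1)] iff by cases auto
      qed
    qed
    show "\<bar>sgn (normal D f $ k)\<bar> = 1" if "f \<in> H" for f using that by (auto simp: H_def sgn_real_def)
    show "((\<lambda>s. h (line s)) has_real_derivative h' (line s)) (at s)" for s
    proof -
      have "((\<lambda>r. h (line s + r *\<^sub>R axis k 1)) has_real_derivative h' (line s)) (at (s - s))"
        using deriv[of "line s"] by simp
      then have "((\<lambda>r. h (line s + (r - s) *\<^sub>R axis k 1)) has_real_derivative h' (line s)) (at s)"
        using DERIV_shift[of "\<lambda>r. h (line s + r *\<^sub>R axis k 1)" "h' (line s)" s "- s"] by simp
      moreover have "line s + (r - s) *\<^sub>R axis k 1 = line r" for r by (simp add: line_def algebra_simps)
      ultimately show ?thesis by simp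
    qed
    show "continuous_on UNIV (\<lambda>s. h' (line s))" using continuous_on_compose2[OF cont cline] by simp
    show "line -` dom D \<in> sets borel" using L by simp
  qed
  also have "\<dots> = (\<Sum>f | normal D f $ k \<noteq> 0. sgn (normal D f $ k) *
      (indicator (face D f) (line (hit_time k x f)) * h (line (hit_time k x f))))"
    by (rule sum.mono_neutral_cong_left) (auto simp: H_def indicator_def)
  finally show ?thesis by (simp add: line_def indicator_vimage o_def)
qed

text \<open>The lines that meet a face parallel to the axis lie in its hyperplane, a null set. The lines through the overlap
of two faces are null because their intersections with a transversal face are, by assumption, null
for the surface measure, and the oblique projection has a density with respect to it.\<close>

lemma AE_good_line:
  "AE x in restrict_space lborel {x. 0 \<le> x $ k \<and> x $ k \<le> 1}. good_line k x"
proof -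
  let ?S = "{x::real^'d. 0 \<le> x $ k \<and> x $ k \<le> 1}"
  let ?M = "restrict_space lborel ?S"
  have Sm[measurable]: "?S \<in> sets borel" by measurable
  have par: "AE x in ?M. \<forall>s. x + s *\<^sub>R axis k 1 \<notin> face D f" if "normal D f $ k = 0" for f
  proof -
    have "normal D f \<noteq> 0" using unit_normal[of f] by auto
    then have "{x. normal D f \<bullet> x = offset D f} \<in> null_sets lebesgue"
      using negligible_hyperplane[of "normal D f" "offset D f"] by (simp add: negligible_iff_null_sets)
    then have "{x. normal D f \<bullet> x = offset D f} \<in> null_sets lborel"
      by (subst (asm) null_sets_completion_iff) (auto intro: borel_closed closed_hyperplane)
    then have "AE x in lborel. normal D f \<bullet> x \<noteq> offset D f" by (rule AE_I') auto
    moreover have "\<forall>s. x + s *\<^sub>R axis k 1 \<notin> face D f" if "normal D f \<bullet> x \<noteq> offset D f" for x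
    proof
      fix s
      have "normal D f \<bullet> (x + s *\<^sub>R axis k 1) \<noteq> offset D f"
        using that \<open>normal D f $ k = 0\<close> by (simp add: inner_add_right inner_axis)
      then show "x + s *\<^sub>R axis k 1 \<notin> face D f" using flat_face[of f] by auto
    qed
    ultimately show ?thesis by (subst AE_restrict_space_iff) (auto elim: eventually_mono)
  qed
  have over: "AE x in ?M. x + hit_time k x f *\<^sub>R axis k 1 \<notin> face D f \<inter> face D f'"
    if n: "normal D f $ k \<noteq> 0" and ff: "f \<noteq> f'" for f f'
  proof -
    have "face D f \<inter> face D f' \<in> null_sets (face_measure D f)" by (rule face_overlap[OF ff])
    then have "AE y in face_measure D f. y \<notin> face D f \<inter> face D f'" by (rule AE_not_in)
    then have "AE y in hyperplane_measure (normal D f) (offset D f). y \<notin> face D f \<inter> face D f'"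
      unfolding face_measure_def .
    then have "AE y in density (hyperplane_measure (normal D f) (offset D f)) (\<lambda>_. ennreal \<bar>normal D f $ k\<bar>). y \<notin> face D f \<inter> face D f'"
      by (subst AE_density) (auto elim: eventually_mono)
    then have "AE y in distr ?M borel (\<lambda>x. x + hit_time k x f *\<^sub>R axis k 1). y \<notin> face D f \<inter> face D f'"
      unfolding distr_hit_point[OF n] .
    then show ?thesis
      by (rule AE_distrD[rotated]) (auto simp: hit_time_def intro!: measurable_restrict_space1)
  qed
  have "AE x in ?M. \<forall>f. normal D f $ k = 0 \<longrightarrow> (\<forall>s. x + s *\<^sub>R axis k 1 \<notin> face D f)"
    using par by (simp add: AE_all_countable)
  moreover have "AE x in ?M. \<forall>f f'. normal D f $ k \<noteq> 0 \<longrightarrow> f \<noteq> f' \<longrightarrow> x + hit_time k x f *\<^sub>R axis k 1 \<notin> face D f \<inter> face D f'"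
    using over by (simp add: AE_all_countable)
  ultimately show ?thesis
  proof eventually_elim
    case (elim x)
    show ?case unfolding good_line_def
    proof (intro allI impI conjI)
      fix f s assume hit: "x + s *\<^sub>R axis k 1 \<in> face D f"
      then show n: "normal D f $ k \<noteq> 0" using elim(1) by blast
      fix f' assume "f' \<noteq> f"
      then show "x + s *\<^sub>R axis k 1 \<notin> face D f'"
        using elim(2) n hit unfolding hit_time_unique[OF n hit] by (metis IntI)
    qed
  qed
qed

lemma integral_over_face:
  fixes h :: "real^'d \<Rightarrow> real"
  assumes n: "normal D f $ k \<noteq> 0" and h: "continuous_on UNIV h"
  defines "G \<equiv> \<lambda>y. indicator (face D f) y * h y"
  shows "integrable lborel (\<lambda>x. indicator {x. 0 \<le> x $ k \<and> x $ k \<le> 1} x * G (x + hit_time k x f *\<^sub>R axis k 1))"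
    and "(\<integral>x. indicator {x. 0 \<le> x $ k \<and> x $ k \<le> 1} x * G (x + hit_time k x f *\<^sub>R axis k 1) \<partial>lborel) =
      \<bar>normal D f $ k\<bar> * (LINT y:face D f|face_measure D f. h y)"
proof -
  let ?S = "{x::real^'d. 0 \<le> x $ k \<and> x $ k \<le> 1}"
  let ?M = "restrict_space lborel ?S"
  define p where "p = (\<lambda>x. x + hit_time k x f *\<^sub>R (axis k 1 :: real^'d))"
  have cp: "continuous_on UNIV p" unfolding p_def hit_time_def using n by (intro continuous_intros) auto
  have Sm[measurable]: "?S \<in> sets borel" by measurable
  have Gm[measurable]: "G \<in> borel_measurable borel"
    unfolding G_def using closed_face[of f] h by (intro borel_measurable_times borel_measurable_indicator borel_measurable_continuous_onI) auto
  have pm[measurable]: "p \<in> borel_measurable borel" using cp by (rule borel_measurable_continuous_onI)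
  have K: "compact (?S \<inter> p -` face D f)"
  proof (subst compact_eq_bounded_closed, intro conjI closed_Int)
    show "closed (p -` face D f)" using continuous_closed_preimage[OF cp closed_UNIV closed_face] by simp
    show "closed ?S" by (intro closed_Collect_conj closed_Collect_le continuous_intros)
    have sub: "face D f \<subseteq> dom D"
      using boundary frontier_subset_closed[OF compact_imp_closed[OF compact_dom]] by blast
    obtain B where B: "\<And>y. y \<in> dom D \<Longrightarrow> norm y \<le> B"
      using compact_imp_bounded[OF compact_dom] by (auto simp: bounded_iff)
    have "norm x \<le> B + (B + 1)" if x: "x \<in> ?S" "p x \<in> face D f" for x
    proof -
      have px: "norm (p x) \<le> B" using x(2) sub B by blast
      have "\<bar>p x $ k\<bar> \<le> B" using px component_le_norm_cart[of "p x" k] by linarith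
      then have t: "\<bar>hit_time k x f\<bar> \<le> B + 1" using x(1) by (auto simp: p_def)
      have "norm x \<le> norm (p x) + norm (hit_time k x f *\<^sub>R (axis k 1 :: real^'d))"
        unfolding p_def by (metis add_diff_cancel_right' norm_triangle_ineq4)
      then show ?thesis using px t by simp
    qed
    then show "bounded (?S \<inter> p -` face D f)" unfolding bounded_iff by blast
  qed
  have "integrable lborel (\<lambda>x. indicator (?S \<inter> p -` face D f) x *\<^sub>R h (p x))"
    using continuous_on_compose2[OF h cp] continuous_on_subset
    by (intro borel_integrable_compact[OF K]) blast
  moreover have "(\<lambda>x. indicator (?S \<inter> p -` face D f) x *\<^sub>R h (p x)) = (\<lambda>x. indicator ?S x * G (p x))"
    by (auto simp: fun_eq_iff G_def indicator_def)
  ultimately show "integrable lborel (\<lambda>x. indicator ?S x * G (x + hit_time k x f *\<^sub>R axis k 1))"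
    by (simp add: p_def)
  have sh: "sets (hyperplane_measure (normal D f) (offset D f)) = sets borel" by (simp add: hyperplane_measure_def)
  have "(\<integral>x. indicator ?S x * G (p x) \<partial>lborel) = (\<integral>x. G (p x) \<partial>?M)"
    by (subst integral_restrict_space) auto
  also have "\<dots> = (\<integral>y. G y \<partial>distr ?M borel p)"
    by (subst integral_distr) (auto intro!: measurable_restrict_space1)
  also have "distr ?M borel p = density (hyperplane_measure (normal D f) (offset D f)) (\<lambda>_. ennreal \<bar>normal D f $ k\<bar>)"
    unfolding p_def by (rule distr_hit_point[OF n])
  also have "(\<integral>y. G y \<partial>density (hyperplane_measure (normal D f) (offset D f)) (\<lambda>_. ennreal \<bar>normal D f $ k\<bar>)) =
    (\<integral>y. \<bar>normal D f $ k\<bar> *\<^sub>R G y \<partial>hyperplane_measure (normal D f) (offset D f))"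
    by (subst integral_density) (auto simp: measurable_cong_sets[OF sh refl])
  finally show "(\<integral>x. indicator ?S x * G (x + hit_time k x f *\<^sub>R axis k 1) \<partial>lborel) =
      \<bar>normal D f $ k\<bar> * (LINT y:face D f|face_measure D f. h y)"
    by (simp add: p_def G_def set_lebesgue_integral_def face_measure_def)
qed

lemma divergence_theorem:
  fixes h h' :: "real^'d \<Rightarrow> real"
  assumes h: "continuous_on UNIV h" and h': "continuous_on UNIV h'"
    and deriv: "\<And>x. ((\<lambda>s. h (x + s *\<^sub>R axis k 1)) has_real_derivative h' x) (at 0)"
  shows "(LINT x:dom D|lborel. h' x) =
    (\<Sum>f\<in>UNIV. normal D f $ k * (LINT x:face D f|face_measure D f. h x))"
proof -
  let ?S = "{x::real^'d. 0 \<le> x $ k \<and> x $ k \<le> 1}"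
  have Sm[measurable]: "?S \<in> sets borel" by measurable
  define G where "G = (\<lambda>f y. indicator (face D f) y * h y)"
  have dm[measurable]: "dom D \<in> sets borel" using compact_imp_closed[OF compact_dom] by simp
  have [measurable]: "h' \<in> borel_measurable borel" "h \<in> borel_measurable borel" 
    using h h' by (auto intro: borel_measurable_continuous_onI)
  have [measurable]: "face D f \<in> sets borel" for f using closed_face[of f] by simp
  have [measurable]: "(\<lambda>x. hit_time k x f) \<in> borel_measurable borel" for f unfolding hit_time_def by measurable
  have "(LINT x:dom D|lborel. h' x) = (\<integral>y. indicator (dom D) y * h' y \<partial>lborel)"
    by (simp add: set_lebesgue_integral_def)
  also have "\<dots> = (\<integral>x. indicator ?S x *
      (\<integral>s. indicator (dom D) (x + s *\<^sub>R axis k 1) * h' (x + s *\<^sub>R axis k 1) \<partial>lborel) \<partial>lborel)"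
    by (rule integral_along_lines[OF compact_dom h'])
  also have "\<dots> = (\<integral>x. (\<Sum>f | normal D f $ k \<noteq> 0. sgn (normal D f $ k) *
      (indicator ?S x * G f (x + hit_time k x f *\<^sub>R axis k 1))) \<partial>lborel)"
  proof (rule integral_cong_AE)
    have "AE x in lborel. x \<in> ?S \<longrightarrow> good_line k x"
      using AE_good_line[of k] by (subst (asm) AE_restrict_space_iff) auto
    then show "AE x in lborel. indicator ?S x *
      (\<integral>s. indicator (dom D) (x + s *\<^sub>R axis k 1) * h' (x + s *\<^sub>R axis k 1) \<partial>lborel) =
      (\<Sum>f | normal D f $ k \<noteq> 0. sgn (normal D f $ k) *
      (indicator ?S x * G f (x + hit_time k x f *\<^sub>R axis k 1)))"
    proof eventually_elim
      case (elim x)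
      show ?case
      proof (cases "x \<in> ?S")
        case True
        then have "good_line k x" using elim by blast
        from integral_along_good_line[OF this h' deriv] True show ?thesis by (simp add: G_def)
      qed simp
    qed
  qed (unfold G_def, measurable)
  also have "\<dots> = (\<Sum>f | normal D f $ k \<noteq> 0. sgn (normal D f $ k) *
      (\<bar>normal D f $ k\<bar> * (LINT y:face D f|face_measure D f. h y)))"
    unfolding G_def using integral_over_face[OF _ h]
    by (subst Bochner_Integration.integral_sum) auto
  also have "\<dots> = (\<Sum>f\<in>UNIV. normal D f $ k * (LINT x:face D f|face_measure D f. h x))"
    by (rule sum.mono_neutral_cong_left) (auto simp: sgn_real_def)
  finally show ?thesis .
qed

end

section \<open>Polynomials and partial derivatives\<close>

lemma finite_exponents: "finite {a :: 'd::finite \<Rightarrow> nat. sum a UNIV \<le> q}"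
proof (rule finite_subset)
  show "{a :: 'd \<Rightarrow> nat. sum a UNIV \<le> q} \<subseteq> PiE UNIV (\<lambda>_. {..q})"
  proof (clarsimp simp: PiE_def)
    fix a :: "'d \<Rightarrow> nat" and i assume "sum a UNIV \<le> q"
    moreover have "a i \<le> sum a UNIV" by (rule member_le_sum) auto
    ultimately show "a i \<le> q" by simp
  qed
qed (auto intro: finite_PiE)

lemma Vpoly_zero: "(\<lambda>x. 0) \<in> Vpoly q"
  unfolding Vpoly_def by (auto intro!: exI[of _ "\<lambda>_. 0"])

lemma Vpoly_add: "f \<in> Vpoly q \<Longrightarrow> g \<in> Vpoly q \<Longrightarrow> (\<lambda>x. f x + g x) \<in> Vpoly q"
  unfolding Vpoly_def
proof clarsimp
  fix c d :: "('a \<Rightarrow> nat) \<Rightarrow> real"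
  show "\<exists>e. (\<lambda>x::real^'a. (\<Sum>a | sum a UNIV \<le> q. c a * (\<Prod>i\<in>UNIV. x $ i ^ a i)) +
      (\<Sum>a | sum a UNIV \<le> q. d a * (\<Prod>i\<in>UNIV. x $ i ^ a i))) =
    (\<lambda>x. \<Sum>a | sum a UNIV \<le> q. e a * (\<Prod>i\<in>UNIV. x $ i ^ a i))"
    by (rule exI[of _ "\<lambda>a. c a + d a"]) (simp add: distrib_right sum.distrib)
qed

lemma Vpoly_scale: "f \<in> Vpoly q \<Longrightarrow> (\<lambda>x. r * f x) \<in> Vpoly q"
  unfolding Vpoly_def
proof clarsimp
  fix c :: "('a \<Rightarrow> nat) \<Rightarrow> real"
  show "\<exists>e. (\<lambda>x::real^'a. r * (\<Sum>a | sum a UNIV \<le> q. c a * (\<Prod>i\<in>UNIV. x $ i ^ a i))) =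
    (\<lambda>x. \<Sum>a | sum a UNIV \<le> q. e a * (\<Prod>i\<in>UNIV. x $ i ^ a i))"
    by (rule exI[of _ "\<lambda>a. r * c a"]) (simp add: sum_distrib_left mult_ac)
qed

lemma Vpoly_sum:
  "(\<And>i. i \<in> I \<Longrightarrow> f i \<in> Vpoly q) \<Longrightarrow> (\<lambda>x. \<Sum>i\<in>I. f i x) \<in> Vpoly q"
  by (induction I rule: infinite_finite_induct) (auto intro: Vpoly_zero Vpoly_add)

lemma Vpoly_monomial:
  fixes a :: "'d::finite \<Rightarrow> nat"
  assumes "sum a UNIV \<le> q"
  shows "(\<lambda>x. \<Prod>i\<in>UNIV. x $ i ^ a i) \<in> Vpoly q"
  unfolding Vpoly_def
proof (clarsimp, rule exI[of _ "\<lambda>b. if b = a then 1 else 0"], rule ext)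
  fix x :: "real^'d"
  have "(\<Sum>b | sum b UNIV \<le> q. (if b = a then 1 else 0) * (\<Prod>i\<in>UNIV. x $ i ^ b i)) =
    (\<Sum>b | sum b UNIV \<le> q. if b = a then (\<Prod>i\<in>UNIV. x $ i ^ b i) else 0)"
    by (rule sum.cong) auto
  also have "\<dots> = (\<Prod>i\<in>UNIV. x $ i ^ a i)"
    by (subst sum.delta[OF finite_exponents]) (simp add: assms)
  finally show "(\<Prod>i\<in>UNIV. x $ i ^ a i) = (\<Sum>b | sum b UNIV \<le> q. (if b = a then 1 else 0) * (\<Prod>i\<in>UNIV. x $ i ^ b i))"
    by simp
qed

lemma Vpoly_induct [consumes 1, case_names monomial zero add scale]:
  fixes f :: "real^'d::finite \<Rightarrow> real"
  assumes f: "f \<in> Vpoly q"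
    and mono: "\<And>a. sum a UNIV \<le> q \<Longrightarrow> P (\<lambda>x. \<Prod>i\<in>UNIV. x $ i ^ a i)"
    and zero: "P (\<lambda>x. 0)"
    and add: "\<And>f g. P f \<Longrightarrow> P g \<Longrightarrow> P (\<lambda>x. f x + g x)"
    and scale: "\<And>f r. P f \<Longrightarrow> P (\<lambda>x. r * f x)"
  shows "P f"
proof -
  obtain c where c: "f = (\<lambda>x. \<Sum>a | sum a UNIV \<le> q. c a * (\<Prod>i\<in>UNIV. x $ i ^ a i))"
    using f by (auto simp: Vpoly_def)
  have "A \<subseteq> {a. sum a UNIV \<le> q} \<Longrightarrow> P (\<lambda>x. \<Sum>a\<in>A. c a * (\<Prod>i\<in>UNIV. x $ i ^ a i))" for A
    by (induction A rule: infinite_finite_induct) (auto intro: zero intro!: add scale mono)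
  then show ?thesis unfolding c by blast
qed

lemma Vpoly_mult:
  assumes f: "f \<in> Vpoly p" and g: "g \<in> Vpoly q"
  shows "(\<lambda>x. f x * g x) \<in> Vpoly (p + q)"
  using f
proof (induction rule: Vpoly_induct)
  case (monomial a)
  show ?case using g
  proof (induction rule: Vpoly_induct)
    case (monomial b)
    have "(\<lambda>x. \<Prod>i\<in>UNIV. x $ i ^ (a i + b i)) \<in> Vpoly (p + q)"
      using \<open>sum a UNIV \<le> p\<close> \<open>sum b UNIV \<le> q\<close>
      by (intro Vpoly_monomial) (simp add: sum.distrib)
    then show ?case by (simp add: power_add prod.distrib)
  next
    case (add f g) then show ?case by (simp add: distrib_left Vpoly_add)
  next
    case (scale f r)
    then show ?case using Vpoly_scale[OF scale, of r] by (simp add: mult_ac)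
  qed (simp add: Vpoly_zero)
next
  case (add f g) then show ?case by (simp add: distrib_right Vpoly_add)
next
  case (scale f r)
  then show ?case using Vpoly_scale[OF scale, of r] by (simp add: mult_ac)
qed (simp add: Vpoly_zero)

lemma partial_eqI: "(f has_derivative f') (at x) \<Longrightarrow> partial k f x = f' (axis k 1)"
  unfolding partial_def by (metis frechet_derivative_at)

lemma monomial_has_derivative:
  fixes a :: "'d::finite \<Rightarrow> nat"
  shows "((\<lambda>x. \<Prod>i\<in>UNIV. x $ i ^ a i) has_derivative
    (\<lambda>y. \<Sum>i\<in>UNIV. (real (a i) * y $ i * x $ i ^ (a i - 1)) * (\<Prod>j\<in>UNIV - {i}. x $ j ^ a j))) (at x)"
  by (rule has_derivative_prod, rule has_derivative_power,
      rule bounded_linear.has_derivative[OF bounded_linear_vec_nth has_derivative_ident])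

text \<open>Differentiability and the degree of the derivative are proved together, because the partial
derivative of a sum is only the sum of the partial derivatives if both exist.\<close>

lemma Vpoly_calculus:
  fixes f :: "real^'d::finite \<Rightarrow> real"
  assumes "f \<in> Vpoly q"
  shows "(\<forall>x. f differentiable (at x)) \<and> partial k f \<in> Vpoly (q - 1)"
  using assms
proof (induction rule: Vpoly_induct)
  case (monomial a)
  let ?f = "\<lambda>x::real^'d. \<Prod>i\<in>UNIV. x $ i ^ a i"
  have "?f differentiable (at x)" for x using monomial_has_derivative by (rule differentiableI)
  moreover have "partial k ?f = (\<lambda>x. real (a k) * (\<Prod>i\<in>UNIV. x $ i ^ (a(k := a k - 1)) i))"
  proof
    fix x :: "real^'d"
    have "partial k ?f x = (\<Sum>i\<in>UNIV. (real (a i) * axis k 1 $ i * x $ i ^ (a i - 1)) * (\<Prod>j\<in>UNIV - {i}. x $ j ^ a j))"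
      by (rule partial_eqI[OF monomial_has_derivative])
    also have "\<dots> = (\<Sum>i\<in>UNIV. if i = k then real (a k) * x $ k ^ (a k - 1) * (\<Prod>j\<in>UNIV - {k}. x $ j ^ a j) else 0)"
      by (rule sum.cong) (auto simp: axis_def)
    also have "\<dots> = real (a k) * (x $ k ^ (a k - 1) * (\<Prod>j\<in>UNIV - {k}. x $ j ^ a j))" by simp
    also have "x $ k ^ (a k - 1) * (\<Prod>j\<in>UNIV - {k}. x $ j ^ a j) = (\<Prod>i\<in>UNIV. x $ i ^ (a(k := a k - 1)) i)"
      by (subst (2) prod.remove[of _ k]) auto
    finally show "partial k ?f x = real (a k) * (\<Prod>i\<in>UNIV. x $ i ^ (a(k := a k - 1)) i)" .
  qed
  moreover have "(\<lambda>x::real^'d. real (a k) * (\<Prod>i\<in>UNIV. x $ i ^ (a(k := a k - 1)) i)) \<in> Vpoly (q - 1)"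
  proof (cases "a k = 0")
    case True then show ?thesis by (simp add: Vpoly_zero)
  next
    case False
    have "sum (a(k := a k - 1)) UNIV = a k - 1 + sum a (UNIV - {k})"
      by (subst sum.remove[of _ k]) auto
    moreover have "sum a UNIV = a k + sum a (UNIV - {k})" by (rule sum.remove) auto
    ultimately have "sum (a(k := a k - 1)) UNIV \<le> q - 1" using monomial False by linarith
    then show ?thesis by (intro Vpoly_scale Vpoly_monomial)
  qed
  ultimately show ?case by simp
next
  case zero
  have "partial k (\<lambda>x::real^'d. 0::real) = (\<lambda>x. 0)" by (auto simp: partial_def)
  then show ?case by (simp add: Vpoly_zero)
next
  case (add f g)
  have "partial k (\<lambda>x. f x + g x) = (\<lambda>x. partial k f x + partial k g x)"
  proof
    fix x
    have "(f has_derivative frechet_derivative f (at x)) (at x)" "(g has_derivative frechet_derivative g (at x)) (at x)"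
      using add by (simp_all add: frechet_derivative_works[symmetric])
    then show "partial k (\<lambda>x. f x + g x) x = partial k f x + partial k g x"
      unfolding partial_def[of k f] partial_def[of k g] by (intro partial_eqI has_derivative_add)
  qed
  then show ?case using add by (simp add: Vpoly_add)
next
  case (scale f r)
  have "partial k (\<lambda>x. r * f x) = (\<lambda>x. r * partial k f x)"
  proof
    fix x
    have "(f has_derivative frechet_derivative f (at x)) (at x)"
      using scale by (simp add: frechet_derivative_works[symmetric])
    then show "partial k (\<lambda>x. r * f x) x = r * partial k f x"
      unfolding partial_def[of k f] by (intro partial_eqI has_derivative_mult_right)
  qed
  then show ?case using scale by (simp add: Vpoly_scale)
qed

lemma Vpoly_differentiable: "f \<in> Vpoly q \<Longrightarrow> f differentiable (at x)"
  using Vpoly_calculus by blast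

lemma Vpoly_partial: "f \<in> Vpoly q \<Longrightarrow> partial k f \<in> Vpoly (q - 1)"
  using Vpoly_calculus by blast

lemma Vpoly_continuous: "f \<in> Vpoly q \<Longrightarrow> continuous_on S f"
  by (meson Vpoly_differentiable continuous_at_imp_continuous_on differentiable_imp_continuous_within)

lemma partial_mult:
  fixes f g :: "real^'d::finite \<Rightarrow> real"
  assumes "f differentiable (at x)" "g differentiable (at x)"
  shows "partial k (\<lambda>x. f x * g x) x = f x * partial k g x + partial k f x * g x"
  using assms unfolding partial_def[of k f] partial_def[of k g] frechet_derivative_works
  by (intro partial_eqI) (rule has_derivative_mult)

lemma has_real_derivative_partial:
  fixes f :: "real^'d::finite \<Rightarrow> real"
  assumes "f differentiable (at x)"
  shows "((\<lambda>s. f (x + s *\<^sub>R axis k 1)) has_real_derivative partial k f x) (at 0)"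
proof -
  have D: "(f has_derivative frechet_derivative f (at x)) (at x)"
    using assms by (rule frechet_derivative_works[THEN iffD1])
  have "((\<lambda>s. x + s *\<^sub>R axis k 1) has_derivative (\<lambda>s. s *\<^sub>R axis k (1::real))) (at 0)"
    by (auto intro!: derivative_eq_intros)
  then have "((\<lambda>s. f (x + s *\<^sub>R axis k 1)) has_derivative (\<lambda>s. frechet_derivative f (at x) (s *\<^sub>R axis k 1))) (at 0)"
    by (rule has_derivative_compose) (simp add: D)
  moreover have "frechet_derivative f (at x) (s *\<^sub>R axis k 1) = partial k f x * s" for s
    using linear_frechet_derivative[OF assms] by (simp add: linear_cmul partial_def)
  ultimately show ?thesis by (simp add: has_field_derivative_def)
qed

lemma partial_vec_nth:
  assumes "F differentiable (at x)"
  shows "partial k F x $ i = partial k (\<lambda>x. F x $ i) x"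
proof -
  have "(F has_derivative frechet_derivative F (at x)) (at x)"
    using assms by (rule frechet_derivative_works[THEN iffD1])
  then have "((\<lambda>x. F x $ i) has_derivative (\<lambda>v. frechet_derivative F (at x) v $ i)) (at x)"
    by (rule bounded_linear.has_derivative[OF bounded_linear_vec_nth])
  from partial_eqI[OF this, of k] show ?thesis by (simp add: partial_def)
qed

lemma has_derivative_vec_lambda:
  fixes f :: "'n::finite \<Rightarrow> 'a::real_normed_vector \<Rightarrow> 'b::euclidean_space"
  assumes "\<And>i. (f i has_derivative f' i) F"
  shows "((\<lambda>x. \<chi> i. f i x) has_derivative (\<lambda>v. \<chi> i. f' i v)) F"
proof -
  have bl: "bounded_linear (axis i :: 'b \<Rightarrow> 'b^'n)" for i
    unfolding linear_conv_bounded_linear[symmetric] by (auto intro!: linearI simp: vec_eq_iff axis_def)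
  have sum: "(\<chi> i. g i) = (\<Sum>i\<in>UNIV. axis i (g i))" for g :: "'n \<Rightarrow> 'b"
    by (simp add: vec_eq_iff axis_def)
  show ?thesis unfolding sum
    by (intro has_derivative_sum bounded_linear.has_derivative[OF bl] assms)
qed

lemma differentiable_vec_lambda:
  fixes f :: "'n::finite \<Rightarrow> 'a::real_normed_vector \<Rightarrow> 'b::euclidean_space"
  assumes "\<And>i. f i differentiable F"
  shows "(\<lambda>x. \<chi> i. f i x) differentiable F"
proof -
  have "(f i has_derivative frechet_derivative (f i) F) F" for i
    using assms by (rule frechet_derivative_works[THEN iffD1])
  then show ?thesis by (rule differentiableI[OF has_derivative_vec_lambda])
qed

section \<open>Quadrature and discrete projection\<close>

lemma qsum_cong: "(\<And>x. x \<in> nodes Q \<Longrightarrow> f x = g x) \<Longrightarrow> qsum Q f = qsum Q g"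
  by (simp add: qsum_def)

lemma qsum_add: "qsum Q (\<lambda>x. f x + g x) = qsum Q f + qsum Q g"
  by (simp add: qsum_def scaleR_add_right sum.distrib)

lemma qsum_mult_left: "qsum Q (\<lambda>x. r * f x) = r * qsum Q f" for r :: real
  by (simp add: qsum_def sum_distrib_left mult_ac)

lemma qsum_diff: "qsum Q (\<lambda>x. f x - g x) = qsum Q f - qsum Q g"
  by (simp add: qsum_def scaleR_diff_right sum_subtractf)

lemma qsum_sum: "qsum Q (\<lambda>x. \<Sum>i\<in>I. f i x) = (\<Sum>i\<in>I. qsum Q (f i))"
  unfolding qsum_def scaleR_sum_right by (rule sum.swap)

lemma qsum_nth: "qsum Q f $ i = qsum Q (\<lambda>x. f x $ i)"
  by (simp add: qsum_def)

text \<open>Gram-Schmidt for a possibly degenerate inner product. If the residual r of the new function has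
norm zero, it vanishes at all nodes and contributes nothing to any equation; the convention that a
quotient by 0 is 0 then gives it the coefficient 0.\<close>

lemma normal_equations_solvable:
  fixes b :: "'i \<Rightarrow> 'a \<Rightarrow> real"
  assumes Q: "finite (nodes Q)" "\<And>x. x \<in> nodes Q \<Longrightarrow> 0 < weight Q x" and I: "finite I"
  shows "\<exists>c. \<forall>i\<in>I. qsum Q (\<lambda>x. (\<Sum>j\<in>I. c j * b j x) * b i x) = qsum Q (\<lambda>x. f x * b i x)"
  using I
proof (induction I arbitrary: f)
  case (insert m I)
  define ip where "ip = (\<lambda>f g :: 'a \<Rightarrow> real. qsum Q (\<lambda>x. f x * g x))"
  obtain c where c: "\<forall>i\<in>I. ip (\<lambda>x. \<Sum>j\<in>I. c j * b j x) (b i) = ip f (b i)"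
    using insert.IH[of f] unfolding ip_def by blast
  obtain d where d: "\<forall>i\<in>I. ip (\<lambda>x. \<Sum>j\<in>I. d j * b j x) (b i) = ip (b m) (b i)"
    using insert.IH[of "b m"] unfolding ip_def by blast
  define y0 where "y0 = (\<lambda>x. \<Sum>j\<in>I. c j * b j x)"
  define z where "z = (\<lambda>x. \<Sum>j\<in>I. d j * b j x)"
  define r where "r = (\<lambda>x. b m x - z x)"
  \<comment> \<open>The component of f - y0 along the residual r of the new function.\<close>
  define t where "t = (ip f r - ip y0 r) / ip r r"
  define y where "y = (\<lambda>x. y0 x + t * r x)"
  have y_left: "ip y g = ip y0 g + t * ip r g" for g
    unfolding ip_def y_def by (simp add: distrib_right qsum_add qsum_mult_left mult.assoc)
  have bm: "ip g (b m) = ip g z + ip g r" for g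
    unfolding ip_def r_def by (simp add: qsum_add[symmetric] algebra_simps)
  have yI: "ip y (b i) = ip f (b i)" if "i \<in> I" for i
  proof -
    have "ip r (b i) = 0" using that d unfolding ip_def r_def z_def by (simp add: left_diff_distrib qsum_diff)
    then show ?thesis using that c y_left[of "b i"] by (simp add: y0_def)
  qed
  have zr: "ip g z = (\<Sum>j\<in>I. d j * ip g (b j))" for g
    unfolding ip_def z_def by (simp add: sum_distrib_left qsum_sum qsum_mult_left[symmetric] mult_ac)
  have yr: "ip y r = ip f r"
  proof (cases "ip r r = 0")
    case True
    have nonneg: "0 \<le> weight Q x * (r x * r x)" if "x \<in> nodes Q" for x
      using Q(2)[OF that] by simp
    have "(\<Sum>x\<in>nodes Q. weight Q x * (r x * r x)) = 0" using True by (simp add: ip_def qsum_def)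
    then have "\<forall>x\<in>nodes Q. weight Q x * (r x * r x) = 0"
      using Q(1) nonneg by (subst (asm) sum_nonneg_eq_0_iff) blast+
    then have "r x = 0" if "x \<in> nodes Q" for x using that Q(2)[OF that] by auto
    then have "ip g r = 0" for g unfolding ip_def by (simp add: qsum_def)
    then show ?thesis by simp
  next
    case False
    then show ?thesis using y_left[of r] by (simp add: t_def)
  qed
  have "ip y (b i) = ip f (b i)" if "i \<in> insert m I" for i
    using that yI yr by (auto simp: bm zr)
  moreover have "y = (\<lambda>x. \<Sum>j\<in>insert m I. (if j = m then t else c j - t * d j) * b j x)"
  proof
    fix x
    have "(\<Sum>j\<in>insert m I. (if j = m then t else c j - t * d j) * b j x) = t * b m x + (\<Sum>j\<in>I. (c j - t * d j) * b j x)"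
      using insert.hyps by (auto intro!: sum.cong)
    also have "\<dots> = y x"
      by (simp add: y_def y0_def r_def z_def algebra_simps sum_subtractf sum_distrib_left)
    finally show "y x = (\<Sum>j\<in>insert m I. (if j = m then t else c j - t * d j) * b j x)" by simp
  qed
  ultimately have "\<forall>i\<in>insert m I. ip (\<lambda>x. \<Sum>j\<in>insert m I. (if j = m then t else c j - t * d j) * b j x) (b i) = ip f (b i)"
    by simp
  then show ?case unfolding ip_def by (intro exI[of _ "\<lambda>j. if j = m then t else c j - t * d j"])
qed simp

lemma dproj_in_Vpoly:
  fixes Q :: "(real^'d::finite) quadrature"
  assumes Q: "finite (nodes Q)" "\<And>x. x \<in> nodes Q \<Longrightarrow> 0 < weight Q x"
  shows "dproj Q q f \<in> Vpoly q"
proof -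
  define E where "E = {a :: 'd \<Rightarrow> nat. sum a UNIV \<le> q}"
  define b where "b = (\<lambda>(a :: 'd \<Rightarrow> nat) (x :: real^'d). \<Prod>i\<in>UNIV. x $ i ^ a i)"
  obtain c where c: "\<And>a. a \<in> E \<Longrightarrow> qsum Q (\<lambda>x. (\<Sum>j\<in>E. c j * b j x) * b a x) = qsum Q (\<lambda>x. f x * b a x)"
    using normal_equations_solvable[OF Q, of E b f] finite_exponents[of q] unfolding E_def by auto
  define y where "y = (\<lambda>x. \<Sum>j\<in>E. c j * b j x)"
  have y: "y \<in> Vpoly q" unfolding y_def b_def E_def
    by (intro Vpoly_sum Vpoly_scale Vpoly_monomial) simp
  have "qsum Q (\<lambda>x. y x * \<psi> x) = qsum Q (\<lambda>x. f x * \<psi> x)" if "\<psi> \<in> Vpoly q" for \<psi>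
    using that
  proof (induction rule: Vpoly_induct)
    case (monomial a)
    then show ?case using c[of a] unfolding y_def b_def E_def by simp
  next
    case (add g h) then show ?case by (simp add: distrib_left qsum_add)
  next
    case (scale g r)
    then show ?case by (simp add: mult.left_commute[of _ r] qsum_mult_left)
  qed simp
  then have "\<exists>y. y \<in> Vpoly q \<and> (\<forall>\<psi>\<in>Vpoly q. qsum Q (\<lambda>x. y x * \<psi> x) = qsum Q (\<lambda>x. f x * \<psi> x))"
    using y by blast
  from someI_ex[OF this] show ?thesis unfolding dproj_def by blast
qed

text \<open>The choice of a solution depends on the function only through the normal equations, so functions
that agree at the nodes have the same projection even when the solution is not unique.\<close>

lemma dproj_cong:
  assumes "\<And>x. x \<in> nodes Q \<Longrightarrow> f x = g x"
  shows "dproj Q q f = dproj Q q g"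
  unfolding dproj_def using assms by (simp cong: qsum_cong)

section \<open>Second derivatives and symmetrization by the energy\<close>

text \<open>Two applications of the mean value theorem, first to the difference of f at points that differ by
h b, along a, and then to the derivative in direction a, along b.\<close>

lemma second_difference_mean_value:
  fixes f :: "'a::real_normed_vector \<Rightarrow> real"
  assumes f: "\<And>y. y \<in> ball x d \<Longrightarrow> (f has_derivative f' y) (at y)"
    and fa: "\<And>y. y \<in> ball x d \<Longrightarrow> ((\<lambda>y. f' y a) has_derivative fa y) (at y)"
    and h: "0 < h" "h * (norm a + norm b) < d"
  shows "\<exists>y\<in>ball x d. f (x + h *\<^sub>R a + h *\<^sub>R b) - f (x + h *\<^sub>R a) - f (x + h *\<^sub>R b) + f x = h\<^sup>2 * fa y b"
proof -
  have inb: "x + s *\<^sub>R a + t *\<^sub>R b \<in> ball x d" if "0 \<le> s" "s \<le> h" "0 \<le> t" "t \<le> h" for s t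
  proof -
    have "norm (s *\<^sub>R a + t *\<^sub>R b) \<le> s * norm a + t * norm b"
      using norm_triangle_ineq[of "s *\<^sub>R a" "t *\<^sub>R b"] that by simp
    also have "\<dots> \<le> h * (norm a + norm b)"
      unfolding distrib_left using that by (intro add_mono mult_right_mono) auto
    finally have "norm (s *\<^sub>R a + t *\<^sub>R b) < d" using h(2) by simp
    moreover have "dist x (x + s *\<^sub>R a + t *\<^sub>R b) = norm (s *\<^sub>R a + t *\<^sub>R b)"
      unfolding dist_norm by (metis add.assoc add_diff_cancel_left' norm_minus_commute)
    ultimately show ?thesis by simp
  qed
  have line: "((\<lambda>s. g (z + s *\<^sub>R v)) has_real_derivative g' v) (at s)"
    if "(g has_derivative g') (at (z + s *\<^sub>R v))" for g :: "'a \<Rightarrow> real" and g' z v s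
  proof -
    have "((\<lambda>s. z + s *\<^sub>R v) has_derivative (\<lambda>r. r *\<^sub>R v)) (at s)"
      by (auto intro!: derivative_eq_intros)
    from has_derivative_compose[OF this that] have "((\<lambda>s. g (z + s *\<^sub>R v)) has_derivative (\<lambda>r. g' (r *\<^sub>R v))) (at s)" .
    moreover have "g' (r *\<^sub>R v) = g' v * r" for r
      using has_derivative_linear[OF that] by (simp add: linear_cmul)
    ultimately show ?thesis by (simp add: has_field_derivative_def)
  qed
  have "\<exists>s>0. s < h \<and> (f (x + h *\<^sub>R b + h *\<^sub>R a) - f (x + h *\<^sub>R a)) - (f (x + h *\<^sub>R b + 0 *\<^sub>R a) - f (x + 0 *\<^sub>R a)) =
    (h - 0) * (f' (x + h *\<^sub>R b + s *\<^sub>R a) a - f' (x + s *\<^sub>R a) a)"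
  proof (rule MVT2[OF h(1)])
    fix s assume s: "0 \<le> s" "s \<le> h"
    have "x + h *\<^sub>R b + s *\<^sub>R a \<in> ball x d" "x + s *\<^sub>R a \<in> ball x d"
      using inb[OF s, of h] inb[OF s, of 0] h(1) by (simp_all add: algebra_simps)
    then show "((\<lambda>s. f (x + h *\<^sub>R b + s *\<^sub>R a) - f (x + s *\<^sub>R a)) has_real_derivative
        f' (x + h *\<^sub>R b + s *\<^sub>R a) a - f' (x + s *\<^sub>R a) a) (at s)"
      by (intro DERIV_diff line f)
  qed
  then obtain s where s: "0 < s" "s < h"
    "f (x + h *\<^sub>R a + h *\<^sub>R b) - f (x + h *\<^sub>R a) - f (x + h *\<^sub>R b) + f x =
     h * (f' (x + s *\<^sub>R a + h *\<^sub>R b) a - f' (x + s *\<^sub>R a) a)"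
    by (auto simp: algebra_simps)
  have "\<exists>t>0. t < h \<and> f' (x + s *\<^sub>R a + h *\<^sub>R b) a - f' (x + s *\<^sub>R a + 0 *\<^sub>R b) a = (h - 0) * fa (x + s *\<^sub>R a + t *\<^sub>R b) b"
  proof (rule MVT2[OF h(1)])
    fix t assume "0 \<le> t" "t \<le> h"
    then have "x + s *\<^sub>R a + t *\<^sub>R b \<in> ball x d" using s by (intro inb) auto
    from line[OF fa[OF this]] show "((\<lambda>t. f' (x + s *\<^sub>R a + t *\<^sub>R b) a) has_real_derivative fa (x + s *\<^sub>R a + t *\<^sub>R b) b) (at t)" .
  qed
  then obtain t where t: "0 < t" "t < h"
    "f' (x + s *\<^sub>R a + h *\<^sub>R b) a - f' (x + s *\<^sub>R a) a = h * fa (x + s *\<^sub>R a + t *\<^sub>R b) b"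
    by auto
  show ?thesis
  proof
    show "x + s *\<^sub>R a + t *\<^sub>R b \<in> ball x d" using s t by (intro inb) auto
    show "f (x + h *\<^sub>R a + h *\<^sub>R b) - f (x + h *\<^sub>R a) - f (x + h *\<^sub>R b) + f x = h\<^sup>2 * fa (x + s *\<^sub>R a + t *\<^sub>R b) b"
      using s(3) t(3) by (simp add: power2_eq_square)
  qed
qed

text \<open>The second difference is symmetric in a and b, and its quotient by the square of h is a value of
either mixed derivative near x.\<close>

lemma symmetric_second_derivative:
  fixes f :: "'a::real_normed_vector \<Rightarrow> real"
  assumes S: "open S" "x \<in> S"
    and f: "\<And>y. y \<in> S \<Longrightarrow> (f has_derivative f' y) (at y)"
    and fa: "\<And>y. y \<in> S \<Longrightarrow> ((\<lambda>y. f' y a) has_derivative fa y) (at y)"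
    and fb: "\<And>y. y \<in> S \<Longrightarrow> ((\<lambda>y. f' y b) has_derivative fb y) (at y)"
    and ca: "continuous_on S (\<lambda>y. fa y b)" and cb: "continuous_on S (\<lambda>y. fb y a)"
  shows "fa x b = fb x a"
proof -
  have "\<bar>fa x b - fb x a\<bar> < \<epsilon>" if "\<epsilon> > 0" for \<epsilon>
  proof -
    have e2: "\<epsilon> / 2 > 0" using that by simp
    obtain d0 where d0: "d0 > 0" "ball x d0 \<subseteq> S" using S openE by blast
    obtain d1 where d1: "d1 > 0" "\<And>y. y \<in> S \<Longrightarrow> dist y x < d1 \<Longrightarrow> dist (fa y b) (fa x b) < \<epsilon> / 2"
      using ca S(2) e2 unfolding continuous_on_iff by metis
    obtain d2 where d2: "d2 > 0" "\<And>y. y \<in> S \<Longrightarrow> dist y x < d2 \<Longrightarrow> dist (fb y a) (fb x a) < \<epsilon> / 2"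
      using cb S(2) e2 unfolding continuous_on_iff by metis
    define d where "d = min d0 (min d1 d2)"
    have d: "d > 0" using d0 d1 d2 by (simp add: d_def)
    have sub: "y \<in> S" if "y \<in> ball x d" for y using that d0(2) by (auto simp: d_def)
    \<comment> \<open>The summand 1 keeps the quotient defined when a = b = 0.\<close>
    define N where "N = norm a + norm b + 1"
    define h where "h = d / (2 * N)"
    have n: "0 < N" unfolding N_def by (smt (verit) norm_ge_zero)
    then have h: "0 < h" using d by (simp add: h_def)
    have "h * (norm a + norm b) \<le> h * N" using h by (simp add: N_def)
    also have "\<dots> = d / 2" using n by (simp add: h_def)
    also have "\<dots> < d" using d by simp
    finally have hd: "h * (norm a + norm b) < d" .
    obtain y where y: "y \<in> ball x d"
      "f (x + h *\<^sub>R a + h *\<^sub>R b) - f (x + h *\<^sub>R a) - f (x + h *\<^sub>R b) + f x = h\<^sup>2 * fa y b"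
      using second_difference_mean_value[of x d f f' a fa h b, OF f[OF sub] fa[OF sub] h hd] by blast
    obtain z where z: "z \<in> ball x d"
      "f (x + h *\<^sub>R b + h *\<^sub>R a) - f (x + h *\<^sub>R b) - f (x + h *\<^sub>R a) + f x = h\<^sup>2 * fb z a"
      using second_difference_mean_value[of x d f f' b fb h a, OF f[OF sub] fb[OF sub] h] hd
      by (auto simp: add.commute)
    have "x + h *\<^sub>R b + h *\<^sub>R a = x + h *\<^sub>R a + h *\<^sub>R b" by (simp add: algebra_simps)
    then have "f (x + h *\<^sub>R b + h *\<^sub>R a) = f (x + h *\<^sub>R a + h *\<^sub>R b)" by (rule arg_cong)
    then have "h\<^sup>2 * fa y b = h\<^sup>2 * fb z a" using y(2) z(2) by linarith
    then have "fa y b = fb z a" using h by simp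
    moreover have "dist (fa y b) (fa x b) < \<epsilon> / 2" using y(1) sub by (intro d1) (auto simp: d_def dist_commute)
    moreover have "dist (fb z a) (fb x a) < \<epsilon> / 2" using z(1) sub by (intro d2) (auto simp: d_def dist_commute)
    ultimately show ?thesis unfolding dist_real_def by argo
  qed
  from this[of "\<bar>fa x b - fb x a\<bar>"] show ?thesis by (cases "fa x b = fb x a") auto
qed

lemma smooth_on_has_derivative:
  assumes "smooth_on S f" "x \<in> S"
  shows "(f has_derivative frechet_derivative f (at x)) (at x)"
proof -
  have "cont_diff_on (Suc 0) S f" using assms(1) by (simp only: smooth_on_def)
  then have "f differentiable (at x)" using assms(2) by simp
  then show ?thesis by (rule frechet_derivative_works[THEN iffD1])
qed

lemma smooth_on_frechet_derivative:
  assumes "smooth_on S f"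
  shows "smooth_on S (\<lambda>x. frechet_derivative f (at x) v)"
  unfolding smooth_on_def
proof
  fix r
  have "cont_diff_on (Suc r) S f" using assms by (simp only: smooth_on_def)
  then show "cont_diff_on r S (\<lambda>x. frechet_derivative f (at x) v)" by simp
qed

lemma smooth_on_continuous_on:
  assumes "smooth_on S f"
  shows "continuous_on S f"
proof -
  have "cont_diff_on 0 S f" using assms by (simp only: smooth_on_def)
  then show ?thesis by simp
qed

text \<open>The linear functional L reduces vector-valued functions, such as the fluxes, to real-valued ones.\<close>

lemma smooth_on_symmetric_second_derivative:
  fixes f :: "'a::euclidean_space \<Rightarrow> 'b::real_normed_vector" and L :: "'b \<Rightarrow> real"
  assumes S: "open S" "x \<in> S" and f: "smooth_on S f" and L: "bounded_linear L"
  shows "L (frechet_derivative (\<lambda>y. frechet_derivative f (at y) a) (at x) b) =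
    L (frechet_derivative (\<lambda>y. frechet_derivative f (at y) b) (at x) a)"
proof -
  note D = bounded_linear.has_derivative[OF L smooth_on_has_derivative]
  note f' = smooth_on_frechet_derivative[OF f]
  note f'' = smooth_on_frechet_derivative[OF f']
  show ?thesis
    by (rule symmetric_second_derivative[OF S D[OF f] D[OF f'] D[OF f']])
       (auto intro!: linear_continuous_on_compose smooth_on_continuous_on[OF f''] bounded_linear.continuous_on[OF L])
qed

lemma grad_has_derivative:
  assumes "smooth_on S f" "u \<in> S"
  shows "(grad f has_derivative (\<lambda>v. \<chi> i. frechet_derivative (\<lambda>u. frechet_derivative f (at u) (axis i 1)) (at u) v)) (at u)"
  unfolding grad_def[abs_def]
  by (intro has_derivative_vec_lambda smooth_on_has_derivative[OF smooth_on_frechet_derivative[OF assms(1)] assms(2)])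

lemma hess_nth:
  assumes "smooth_on S f" "u \<in> S"
  shows "hess f u $ i $ j = frechet_derivative (\<lambda>u. frechet_derivative f (at u) (axis i 1)) (at u) (axis j 1)"
  unfolding hess_def jacobian_def frechet_derivative_at[OF grad_has_derivative[OF assms], symmetric]
  by (simp add: matrix_def)

lemma bounded_bilinear_matrix_vector_mult: "bounded_bilinear ((*v) :: real^'n^'m \<Rightarrow> real^'n \<Rightarrow> real^'m)"
  unfolding bilinear_conv_bounded_bilinear[symmetric] bilinear_def
  by (auto intro!: linearI simp: matrix_vector_mult_add_rdistrib matrix_vector_right_distrib
      scaleR_matrix_vector_assoc[symmetric] matrix_vector_mult_scaleR)

lemma bounded_bilinear_matrix_matrix_mult: "bounded_bilinear ((**) :: real^'n^'m \<Rightarrow> real^'k^'n \<Rightarrow> real^'k^'m)"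
  unfolding bilinear_conv_bounded_bilinear[symmetric] bilinear_def
  by (auto intro!: linearI simp: matrix_matrix_mult_def vec_eq_iff sum.distrib sum_distrib_left algebra_simps)

lemma symmetric_entries:
  assumes "transpose M = M"
  shows "M $ i $ j = M $ j $ i"
proof -
  have "transpose M $ i $ j = M $ j $ i" by (simp add: transpose_def)
  then show ?thesis using assms by simp
qed

context energy_system
begin

text \<open>Differentiating the compatibility relation in direction l gives the (l, j) entry of the product,
plus the gradient of e paired with a second derivative of the flux, equal to a second derivative of
the energy flux. The last two are symmetric in l and j.\<close>

lemma hess_Amat_symmetric:
  assumes u: "u \<in> adm P"
  shows "transpose (hess (energy P) u ** Amat P k u) = hess (energy P) u ** Amat P k u"
proof -
  define E where "E = grad (energy P)"
  define DE where "DE = (\<lambda>v. \<chi> i. frechet_derivative (\<lambda>u. frechet_derivative (energy P) (at u) (axis i 1)) (at u) v)"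
  define Fl where "Fl = (\<lambda>j u. frechet_derivative (flux P k) (at u) (axis j 1))"
  define DF where "DF = (\<lambda>j. frechet_derivative (Fl j) (at u))"
  define G where "G = (\<lambda>j u. frechet_derivative (eflux P k) (at u) (axis j 1))"
  define DG where "DG = (\<lambda>j. frechet_derivative (G j) (at u))"
  have DE: "(E has_derivative DE) (at u)"
    unfolding E_def DE_def by (rule grad_has_derivative[OF smooth_energy u])
  have DF: "(Fl j has_derivative DF j) (at u)" for j
    unfolding DF_def Fl_def by (intro smooth_on_has_derivative[OF smooth_on_frechet_derivative[OF smooth_flux] u])
  have DG: "(G j has_derivative DG j) (at u)" for j
    unfolding DG_def G_def by (intro smooth_on_has_derivative[OF smooth_on_frechet_derivative[OF smooth_eflux] u])
  have comp: "E w \<bullet> Fl j w = G j w" if w: "w \<in> adm P" for j w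
  proof -
    have "(grad (energy P) w v* Amat P k w) $ j = grad (eflux P k) w $ j"
      using compatible[OF w] by simp
    then show ?thesis
      by (simp add: vector_matrix_mult_def Amat_def jacobian_def matrix_def E_def Fl_def G_def grad_def inner_vec_def mult.commute)
  qed
  have eq: "DE (axis l 1) \<bullet> Fl j u + E u \<bullet> DF j (axis l 1) = DG j (axis l 1)" for j l
  proof -
    have "((\<lambda>w. E w \<bullet> Fl j w) has_derivative (\<lambda>v. E u \<bullet> DF j v + DE v \<bullet> Fl j u)) (at u)"
      by (rule has_derivative_inner[OF DE DF])
    then have "(G j has_derivative (\<lambda>v. E u \<bullet> DF j v + DE v \<bullet> Fl j u)) (at u)"
      by (rule has_derivative_transform_within_open[OF _ open_adm u]) (rule comp)
    from has_derivative_unique[OF this DG[of j]] show ?thesis by (metis add.commute)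
  qed
  have "E u \<bullet> DF j (axis l 1) = E u \<bullet> DF l (axis j 1)" for j l
    unfolding DF_def Fl_def
    using smooth_on_symmetric_second_derivative[OF open_adm u smooth_flux bounded_linear_inner_right] by fast
  moreover have "DG j (axis l 1) = DG l (axis j 1)" for j l
    unfolding DG_def G_def
    by (rule smooth_on_symmetric_second_derivative[OF open_adm u smooth_eflux bounded_linear_ident])
  ultimately have sym: "DE (axis l 1) \<bullet> Fl j u = DE (axis j 1) \<bullet> Fl l u" for j l
    using eq[of l j] eq[of j l] by (metis add_right_imp_eq)
  \<comment> \<open>By definition the entry is the derivative of the l-th component of E in direction i. The symmetry
    of the Hessian exchanges the roles of the two indices.\<close>
  have hs: "hess (energy P) u $ l $ i = DE (axis l 1) $ i" for l i
  proof -
    have "hess (energy P) u $ l $ i = hess (energy P) u $ i $ l"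
      using hess_spd[OF u] unfolding spd_def by (intro symmetric_entries) simp
    then show ?thesis by (simp add: hess_nth[OF smooth_energy u] DE_def)
  qed
  have "(hess (energy P) u ** Amat P k u) $ l $ j = DE (axis l 1) \<bullet> Fl j u" for l j
    by (simp add: matrix_matrix_mult_def hs inner_vec_def Amat_def jacobian_def matrix_def Fl_def)
  then show ?thesis using sym by (simp add: transpose_def vec_eq_iff)
qed

lemma H_Amat_symmetric:
  assumes u: "u \<in> adm P"
  shows "(Hmat P u ** Amat P k u) $ i $ j = (Hmat P u ** Amat P k u) $ j $ i"
proof -
  have "(hess (energy P) u ** Amat P k u) $ i $ j = (hess (energy P) u ** Amat P k u) $ j $ i"
    by (rule symmetric_entries[OF hess_Amat_symmetric[OF u]])
  then show ?thesis by (simp add: Hmat_def scalar_matrix_assoc[symmetric])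
qed

text \<open>At u = 0 the factor of H is a quotient by 0 and hence 0, so H would have the eigenvalue 0.\<close>

lemma adm_nonzero:
  assumes u: "u \<in> adm P"
  shows "u \<noteq> 0"
proof
  assume "u = 0"
  then have "Hmat P u *v axis k 1 = 0 *\<^sub>R axis k 1" for k by (simp add: Hmat_def)
  from H_eigenvalues[OF u _ this] bounds(1) show False by (simp add: axis_eq_0_iff)
qed

lemma Hmat_differentiable:
  assumes u: "u \<in> adm P"
  shows "Hmat P differentiable (at u)"
proof -
  define K where "K = (\<lambda>u. \<chi> i j. frechet_derivative (\<lambda>u. frechet_derivative (energy P) (at u) (axis i 1)) (at u) (axis j 1))"
  have K: "hess (energy P) w = K w" if "w \<in> adm P" for w
    using hess_nth[OF smooth_energy that] by (simp add: vec_eq_iff K_def)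
  have dK: "K differentiable (at u)" unfolding K_def
    by (intro differentiable_vec_lambda differentiableI[OF smooth_on_has_derivative[OF smooth_on_frechet_derivative[OF smooth_on_frechet_derivative[OF smooth_energy]] u]])
  have dKu: "(\<lambda>w. K w *v w) differentiable (at u)"
    using bounded_bilinear.FDERIV[OF bounded_bilinear_matrix_vector_mult dK[unfolded frechet_derivative_works] has_derivative_ident]
    by (rule differentiableI)
  have de: "energy P differentiable (at u)"
    by (rule differentiableI[OF smooth_on_has_derivative[OF smooth_energy u]])
  have "0 < u \<bullet> (K u *v u)"
    using hess_spd[OF u] adm_nonzero[OF u] K[OF u] by (simp add: spd_def)
  then have "(\<lambda>w. (2 * energy P w / (w \<bullet> (K w *v w))) *\<^sub>R K w) differentiable (at u)"
    by (intro differentiable_scaleR differentiable_divide differentiable_mult differentiable_inner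
        differentiable_ident differentiable_const dK dKu de) simp
  then obtain D where "((\<lambda>w. (2 * energy P w / (w \<bullet> (K w *v w))) *\<^sub>R K w) has_derivative D) (at u)"
    by (auto simp: differentiable_def)
  then have "(Hmat P has_derivative D) (at u)"
    by (rule has_derivative_transform_within_open[OF _ open_adm u]) (simp add: Hmat_def K)
  then show ?thesis by (rule differentiableI)
qed

end

section \<open>The Cholesky factor\<close>

lemma lex_less_linear: "lex_less a b \<or> a = b \<or> lex_less b a"
  by (auto simp: lex_less_def prod_eq_iff)

lemma lex_less_irrefl: "\<not> lex_less a a"
  by (simp add: lex_less_def)

lemma lex_less_trans: "lex_less a b \<Longrightarrow> lex_less b c \<Longrightarrow> lex_less a c"
  by (auto simp: lex_less_def)

lemma lex_less_induct [case_names less]: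
  fixes a :: "'n::{finite,linorder} \<times> 'm::{finite,linorder}"
  assumes "\<And>a. (\<And>c. lex_less c a \<Longrightarrow> P c) \<Longrightarrow> P a"
  shows "P a"
proof (induction a rule: measure_induct_rule[of "\<lambda>a. card {c. lex_less c a}"])
  case (less a)
  show ?case
  proof (rule assms)
    fix c assume "lex_less c a"
    then have "{d. lex_less d c} \<subset> {d. lex_less d a}"
      using lex_less_trans lex_less_irrefl by blast
    then show "P c" by (intro less psubset_card_mono) simp_all
  qed
qed

lemma lex_greater_induct [case_names greater]:
  fixes a :: "'n::{finite,linorder} \<times> 'm::{finite,linorder}"
  assumes "\<And>a. (\<And>c. lex_less a c \<Longrightarrow> P c) \<Longrightarrow> P a"
  shows "P a"
proof (induction a rule: measure_induct_rule[of "\<lambda>a. card {c. lex_less a c}"])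
  case (less a)
  show ?case
  proof (rule assms)
    fix c assume "lex_less a c"
    then have "{d. lex_less c d} \<subset> {d. lex_less a d}"
      using lex_less_trans lex_less_irrefl by blast
    then show "P c" by (intro less psubset_card_mono) simp_all
  qed
qed

lemma cholesky_factorD:
  assumes "cholesky_factor M R"
  shows "M = transpose R ** R" "lex_less b a \<Longrightarrow> R $ a $ b = 0" "0 < R $ a $ a"
  using assms unfolding cholesky_factor_def by blast+

text \<open>Back substitution: solving R v = 0 from the last row upwards shows that v vanishes.\<close>

lemma cholesky_factor_invertible:
  assumes "cholesky_factor M R"
  shows "invertible R"
proof -
  have "v = 0" if v: "R *v v = 0" for v
  proof -
    have "v $ a = 0" for a
    proof (induction a rule: lex_greater_induct)
      case (greater a)
      have "R $ a $ b * v $ b = 0" if "b \<noteq> a" for b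
        using lex_less_linear[of a b] that greater[of b] cholesky_factorD(2)[OF assms, of b a] by auto
      then have "(R *v v) $ a = R $ a $ a * v $ a"
        unfolding matrix_vector_mult_def vec_lambda_beta
        by (subst sum.remove[of _ a]) (simp_all add: sum.neutral del: split_paired_All)
      then have "R $ a $ a * v $ a = 0" using v by simp
      then show ?case using cholesky_factorD(3)[OF assms, of a] by simp
    qed
    then show ?thesis by (simp add: vec_eq_iff)
  qed
  then show ?thesis using invertible_left_inverse matrix_left_invertible_ker by blast
qed

text \<open>Only the rows up to the a-th contribute, since the factor is upper triangular. This is the Cholesky
recursion, which determines the a-th row from the earlier ones.\<close>

lemma cholesky_factor_entry:
  assumes "cholesky_factor M R"
  shows "M $ a $ b = (\<Sum>c | lex_less c a. R $ c $ a * R $ c $ b) + R $ a $ a * R $ a $ b"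
proof -
  have "M $ a $ b = (\<Sum>c\<in>UNIV. R $ c $ a * R $ c $ b)"
    unfolding cholesky_factorD(1)[OF assms] by (simp add: matrix_matrix_mult_def transpose_def)
  also have "\<dots> = (\<Sum>c\<in>insert a {c. lex_less c a}. R $ c $ a * R $ c $ b)"
  proof (rule sum.mono_neutral_right)
    show "\<forall>c\<in>UNIV - insert a {c. lex_less c a}. R $ c $ a * R $ c $ b = 0"
    proof
      fix c assume "c \<in> UNIV - insert a {c. lex_less c a}"
      then have "lex_less a c" using lex_less_linear[of a c] by auto
      then show "R $ c $ a * R $ c $ b = 0" using cholesky_factorD(2)[OF assms] by simp
    qed
  qed auto
  finally show ?thesis by (simp add: lex_less_irrefl add.commute)
qed

lemma differentiable_transform_open:
  assumes "f differentiable (at t)" "open T" "t \<in> T" "\<And>s. s \<in> T \<Longrightarrow> f s = g s"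
  shows "g differentiable (at t)"
  using assms has_derivative_transform_within_open unfolding differentiable_def by blast

lemma differentiable_vec_nth: "f differentiable F \<Longrightarrow> (\<lambda>s. f s $ i) differentiable F"
  unfolding differentiable_def using bounded_linear.has_derivative[OF bounded_linear_vec_nth] by blast

text \<open>Induction on the rows along the recursion. The entry on the diagonal is the square root of a
quantity that is positive at t since the diagonal of a Cholesky factor is positive; the other entries
of the row are quotients by it.\<close>

lemma cholesky_factor_differentiable:
  fixes M R :: "real \<Rightarrow> real^('n::{finite,linorder} \<times> 'm::{finite,linorder})^('n \<times> 'm)"
  assumes T: "open T" "t \<in> T" and M: "M differentiable (at t)"
    and R: "\<And>s. s \<in> T \<Longrightarrow> cholesky_factor (M s) (R s)"
  shows "R differentiable (at t)"
proof -
  have M': "(\<lambda>s. M s $ a $ b) differentiable (at t)" for a b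
    using M by (intro differentiable_vec_nth)
  have pos: "0 < R s $ a $ a" if "s \<in> T" for s a by (rule cholesky_factorD(3)[OF R[OF that]])
  have "\<forall>b. (\<lambda>s. R s $ a $ b) differentiable (at t)" for a
  proof (induction a rule: lex_less_induct)
    case (less a)
    define q where "q = (\<lambda>b s. M s $ a $ b - (\<Sum>c | lex_less c a. R s $ c $ a * R s $ c $ b))"
    have dq: "q b differentiable (at t)" for b
      unfolding q_def by (intro differentiable_diff M' differentiable_sum differentiable_mult ballI)
        (use less in \<open>simp_all del: split_paired_All\<close>)
    have q: "q b s = R s $ a $ a * R s $ a $ b" if "s \<in> T" for b s
      using cholesky_factor_entry[OF R[OF that], of a b] by (simp add: q_def)
    have "q a t > 0" using q[OF T(2)] pos[OF T(2)] by simp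
    then have "(\<lambda>s. sqrt (q a s)) differentiable (at t)"
      using dq[of a] unfolding differentiable_def by (blast intro: has_derivative_real_sqrt)
    then have diag: "(\<lambda>s. R s $ a $ a) differentiable (at t)"
    proof (rule differentiable_transform_open[OF _ T])
      fix s assume "s \<in> T"
      then show "sqrt (q a s) = R s $ a $ a" using q pos[of s a] by simp
    qed
    show ?case
    proof
      fix b
      have "(\<lambda>s. q b s / R s $ a $ a) differentiable (at t)"
        using pos[OF T(2), of a] by (intro differentiable_divide dq diag) simp
      then show "(\<lambda>s. R s $ a $ b) differentiable (at t)"
      proof (rule differentiable_transform_open[OF _ T])
        fix s assume "s \<in> T"
        then show "q b s / R s $ a $ a = R s $ a $ b" using q pos[of s a] by simp
      qed
    qed
  qed
  then have "(\<lambda>s. \<chi> a b. R s $ a $ b) differentiable (at t)"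
    by (intro differentiable_vec_lambda) blast
  then show ?thesis by simp
qed

section \<open>Discrete integration by parts\<close>

text \<open>The Kronecker product of the row \<phi> with an identity matrix. The basis matrix and its partial
derivatives have this form.\<close>

definition scalar_block :: "('n \<Rightarrow> real) \<Rightarrow> real^('n::finite \<times> 'm::finite)^'m" where
  "scalar_block \<phi> = (\<chi> i a. if i = snd a then \<phi> (fst a) else 0)"

lemma scalar_block_product_entry:
  "(transpose (scalar_block \<phi>) ** Y ** scalar_block \<psi>) $ a $ b =
    \<phi> (fst a) * Y $ snd a $ snd b * \<psi> (fst b)"
proof -
  have "(transpose (scalar_block \<phi>) ** Y) $ a $ j = \<phi> (fst a) * Y $ snd a $ j" for j
    unfolding matrix_matrix_mult_def transpose_def scalar_block_def
    by (simp add: if_distrib[of "\<lambda>z. z * _"] cong: if_cong)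
  then show ?thesis
    unfolding matrix_matrix_mult_def[of "_ ** _"] scalar_block_def
    by (simp add: if_distrib[of "\<lambda>z. _ * z"] cong: if_cong)
qed

lemma Phi_eq_scalar_block: "Phi D x = scalar_block (\<lambda>\<alpha>. basis D \<alpha> x)"
  by (simp add: Phi_def scalar_block_def)

context cpg_element
begin

lemma Phi_differentiable: "Phi D differentiable (at x)"
  unfolding Phi_def[abs_def]
proof (intro differentiable_vec_lambda)
  fix i a show "(\<lambda>x. if i = snd a then basis D (fst a) x else 0) differentiable (at x)"
    by (cases "i = snd a") (simp_all add: Vpoly_differentiable[OF basis_in])
qed

lemma partial_Phi: "partial k (Phi D) x = scalar_block (\<lambda>\<alpha>. partial k (basis D \<alpha>) x)"
proof -
  have "partial k (Phi D) x $ i $ a = (if i = snd a then partial k (basis D (fst a)) x else 0)" for i a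
  proof -
    have "partial k (Phi D) x $ i $ a = partial k (\<lambda>x. Phi D x $ i $ a) x"
      by (simp only: partial_vec_nth[OF Phi_differentiable] partial_vec_nth[OF differentiable_vec_nth[OF Phi_differentiable]])
    also have "\<dots> = (if i = snd a then partial k (basis D (fst a)) x else 0)"
      by (cases "i = snd a") (simp_all add: Phi_def partial_def)
    finally show ?thesis .
  qed
  then show ?thesis unfolding vec_eq_iff scalar_block_def vec_lambda_beta by blast
qed

lemma Yproj_in_Vpoly: "(\<lambda>x. Yproj P D X U k x $ i $ j) \<in> Vpoly (deg D + 1)"
  using Qhi_exact by (simp add: Yproj_def exact_quadrature_def dproj_in_Vpoly)

lemma partial_Yproj: "partial k (Yproj P D X U k) x $ i $ j = partial k (\<lambda>x. Yproj P D X U k x $ i $ j) x"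
proof -
  have "(\<lambda>x. \<chi> i j. Yproj P D X U k x $ i $ j) differentiable (at x)"
    by (intro differentiable_vec_lambda Vpoly_differentiable[OF Yproj_in_Vpoly])
  then have "Yproj P D X U k differentiable (at x)" by simp
  then show ?thesis by (simp add: partial_vec_nth differentiable_vec_nth)
qed

text \<open>The partial derivative lowers the degree by one, which is why the volume quadrature needs one degree
less of exactness than the face quadratures.\<close>

lemma quadrature_divergence:
  assumes g: "\<And>k. g k \<in> Vpoly (3 * deg D + 1)"
  shows "qsum (Qvol D) (\<lambda>x. \<Sum>k\<in>UNIV. partial k (g k) x) =
    (\<Sum>f\<in>UNIV. qsum (Qface D f) (\<lambda>x. \<Sum>k\<in>UNIV. normal D f $ k * g k x))"
proof -
  have "qsum (Qvol D) (partial k (g k)) = (\<Sum>f\<in>UNIV. normal D f $ k * qsum (Qface D f) (g k))" for k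
  proof -
    have pg: "partial k (g k) \<in> Vpoly (3 * deg D)" using Vpoly_partial[OF g[of k], of k] by simp
    then have "qsum (Qvol D) (partial k (g k)) = (LINT x:dom D|lborel. partial k (g k) x)"
      using Qvol_exact by (simp add: exact_quadrature_def)
    also have "\<dots> = (\<Sum>f\<in>UNIV. normal D f $ k * (LINT x:face D f|face_measure D f. g k x))"
      by (intro divergence_theorem Vpoly_continuous[OF g] Vpoly_continuous[OF pg]
          has_real_derivative_partial Vpoly_differentiable[OF g])
    also have "\<dots> = (\<Sum>f\<in>UNIV. normal D f $ k * qsum (Qface D f) (g k))"
      using Qface_exact g by (simp add: exact_quadrature_def)
    finally show ?thesis .
  qed
  then show ?thesis
    by (simp add: qsum_sum qsum_mult_left) (rule sum.swap)
qed

end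

text \<open>Each entry is the exact quadrature of the product rule for a basis function times an entry of Y times
another basis function. The derivative of the first factor yields the transposed entry because Y is
symmetric: the projected functions agree at the nodes of the high-order quadrature.\<close>

lemma summation_by_parts:
  fixes P :: "('m::finite, 'd::finite) system" and D :: "('d, 'f::finite, 'n::finite) element"
    and U :: "real^('n \<times> 'm)"
  assumes P: "energy_system P cH CH" and D: "cpg_element D n"
    and U: "\<And>x. x \<in> nodes (Qhi D) \<Longrightarrow> u_p D U x \<in> adm P"
  shows "N_op P D U + transpose (N_op P D U) + V_op P D U = B_op P D U"
proof -
  interpret energy_system P cH CH by fact
  interpret cpg_element D n by fact
  have "(N_op P D U + transpose (N_op P D U) + V_op P D U) $ a $ b = B_op P D U $ a $ b" for a b
  proof -
    define \<phi> where "\<phi> = basis D (fst a)"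
    define \<psi> where "\<psi> = basis D (fst b)"
    define y where "y = (\<lambda>k x. Yproj P D (Amat P) U k x $ snd a $ snd b)"
    have y: "y k \<in> Vpoly (deg D + 1)" for k unfolding y_def by (rule Yproj_in_Vpoly)
    have \<phi>\<psi>: "\<phi> \<in> Vpoly (deg D)" "\<psi> \<in> Vpoly (deg D)" by (simp_all add: \<phi>_def \<psi>_def basis_in)
    have sym: "Yproj P D (Amat P) U k x $ snd b $ snd a = y k x" for k x
      unfolding y_def Yproj_def vec_lambda_beta by (intro fun_cong[OF dproj_cong] H_Amat_symmetric U)
    have N: "N_op P D U $ a $ b = qsum (Qvol D) (\<lambda>x. \<Sum>k\<in>UNIV. \<phi> x * y k x * partial k \<psi> x)"
      unfolding N_op_def qsum_nth sum_component partial_Phi Phi_eq_scalar_block scalar_block_product_entry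
      by (simp add: \<phi>_def \<psi>_def y_def)
    have NT: "N_op P D U $ b $ a = qsum (Qvol D) (\<lambda>x. \<Sum>k\<in>UNIV. \<psi> x * y k x * partial k \<phi> x)"
      unfolding N_op_def qsum_nth sum_component partial_Phi Phi_eq_scalar_block scalar_block_product_entry
      by (simp add: \<phi>_def \<psi>_def sym)
    have V: "V_op P D U $ a $ b = qsum (Qvol D) (\<lambda>x. \<Sum>k\<in>UNIV. \<phi> x * partial k (y k) x * \<psi> x)"
      unfolding V_op_def qsum_nth sum_component Phi_eq_scalar_block scalar_block_product_entry partial_Yproj
      by (simp add: \<phi>_def \<psi>_def y_def)
    have B: "B_op P D U $ a $ b = (\<Sum>f\<in>UNIV. qsum (Qface D f) (\<lambda>x. \<Sum>k\<in>UNIV. normal D f $ k * (\<phi> x * y k x * \<psi> x)))"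
      unfolding B_op_def bdry_op_def sum_component qsum_nth vector_scaleR_component Phi_eq_scalar_block scalar_block_product_entry
      by (simp add: \<phi>_def \<psi>_def y_def)
    have g: "(\<lambda>x. \<phi> x * y k x * \<psi> x) \<in> Vpoly (3 * deg D + 1)" for k
      using Vpoly_mult[OF Vpoly_mult[OF \<phi>\<psi>(1) y] \<phi>\<psi>(2), of k]
      by (simp add: numeral_3_eq_3 add.assoc)
    have d: "\<phi> differentiable (at x)" "\<psi> differentiable (at x)" "y k differentiable (at x)" for k x
      using y \<phi>\<psi> Vpoly_differentiable by blast+
    have "partial k (\<lambda>x. \<phi> x * y k x * \<psi> x) x =
      \<phi> x * y k x * partial k \<psi> x + \<psi> x * y k x * partial k \<phi> x + \<phi> x * partial k (y k) x * \<psi> x" for k x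
      using d by (simp add: partial_mult differentiable_mult algebra_simps)
    then have "N_op P D U $ a $ b + N_op P D U $ b $ a + V_op P D U $ a $ b =
      qsum (Qvol D) (\<lambda>x. \<Sum>k\<in>UNIV. partial k (\<lambda>x. \<phi> x * y k x * \<psi> x) x)"
      unfolding N NT V by (simp add: qsum_add[symmetric] sum.distrib)
    also have "\<dots> = B_op P D U $ a $ b" unfolding B by (rule quadrature_divergence[OF g])
    finally show ?thesis by (simp add: transpose_def)
  qed
  then show ?thesis by (simp add: vec_eq_iff)
qed

section \<open>The mass matrix along a trajectory\<close>

lemma u_p_has_vector_derivative:
  assumes "U differentiable (at t)"
  shows "((\<lambda>s. u_p D (U s) x) has_vector_derivative Phi D x *v vector_derivative U (at t)) (at t)"
  unfolding u_p_def
  using assms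
  by (intro bounded_linear.has_vector_derivative[OF matrix_vector_mul_bounded_linear])
     (simp add: vector_derivative_works)

lemma mass_dot_eq_mass_dir:
  assumes "U differentiable (at t)"
  shows "mass_dot P D U t = mass_dir P D (U t) (vector_derivative U (at t))"
  unfolding mass_dot_def mass_dir_def
  by (simp add: vector_derivative_at[OF u_p_has_vector_derivative[OF assms]])

lemma (in energy_system) mass_op_has_vector_derivative:
  assumes U: "U differentiable (at t)" and adm: "\<And>x. x \<in> nodes (Qvol D) \<Longrightarrow> u_p D (U t) x \<in> adm P"
  shows "((\<lambda>s. mass_op P D (U s)) has_vector_derivative mass_dot P D U t) (at t)"
proof -
  have "((\<lambda>s. transpose (Phi D x) ** Hmat P (u_p D (U s) x) ** Phi D x) has_vector_derivative
      transpose (Phi D x) ** frechet_derivative (Hmat P) (at (u_p D (U t) x))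
       (vector_derivative (\<lambda>s. u_p D (U s) x) (at t)) ** Phi D x) (at t)" if x: "x \<in> nodes (Qvol D)" for x
  proof -
    have H: "(Hmat P has_derivative frechet_derivative (Hmat P) (at (u_p D (U t) x))) (at (u_p D (U t) x))"
      using Hmat_differentiable[OF adm[OF x]] by (simp add: frechet_derivative_works)
    have V: "((\<lambda>s. u_p D (U s) x) has_vector_derivative vector_derivative (\<lambda>s. u_p D (U s) x) (at t)) (at t)"
      using u_p_has_vector_derivative[OF U, of D x] by (simp add: vector_derivative_at)
    have "(Hmat P \<circ> (\<lambda>s. u_p D (U s) x) has_vector_derivative frechet_derivative (Hmat P) (at (u_p D (U t) x))
       (vector_derivative (\<lambda>s. u_p D (U s) x) (at t))) (at t)"
      by (rule vector_derivative_diff_chain_within[OF V has_derivative_at_withinI[OF H]])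
    then have "((\<lambda>s. Hmat P (u_p D (U s) x)) has_vector_derivative frechet_derivative (Hmat P) (at (u_p D (U t) x))
       (vector_derivative (\<lambda>s. u_p D (U s) x) (at t))) (at t)"
      by (simp add: o_def)
    then show ?thesis
      by (intro bounded_linear.has_vector_derivative[OF bounded_bilinear.bounded_linear_left[OF bounded_bilinear_matrix_matrix_mult]]
          bounded_linear.has_vector_derivative[OF bounded_bilinear.bounded_linear_right[OF bounded_bilinear_matrix_matrix_mult]])
  qed
  then show ?thesis unfolding mass_op_def mass_dot_def qsum_def
    by (intro has_vector_derivative_sum bounded_linear.has_vector_derivative[OF bounded_linear_scaleR_right])
qed

section \<open>The closure and the orthogonalized operators\<close>

text \<open>The closed operator maps w to a vector orthogonal to w, so of the two terms of the wedge only the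
first survives.\<close>

lemma K_EC_vector:
  assumes "w \<noteq> 0"
  shows "K_EC w C *v w = C *v w - ((w \<bullet> (C *v w)) / norm w ^ 2) *\<^sub>R w"
proof -
  have outer: "outer v z *v x = (z \<bullet> x) *\<^sub>R v" for v z x :: "real^'a"
    by (simp add: outer_def matrix_vector_mult_def vec_eq_iff inner_vec_def sum_distrib_left mult_ac)
  have nw: "norm w ^ 2 \<noteq> 0" "w \<bullet> w = norm w ^ 2"
    using assms by (simp_all add: dot_square_norm)
  have cancel: "r * norm w ^ 2 / norm w ^ 4 = r / norm w ^ 2" for r
    using assms by (simp add: divide_simps power2_eq_square power4_eq_xxxx)
  have EC: "C_EC w C *v w = C *v w - ((w \<bullet> (C *v w)) / norm w ^ 2) *\<^sub>R w"
    using nw by (simp add: C_EC_def L_closure_def matrix_vector_mult_diff_rdistrib scaleR_matrix_vector_assoc[symmetric] outer cancel)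
  then have "w \<bullet> (C_EC w C *v w) = 0" using nw by (simp add: inner_diff_right)
  then have "K_EC w C *v w = C_EC w C *v w"
    using nw by (simp add: K_EC_def matrix_vector_mult_diff_rdistrib scaleR_matrix_vector_assoc[symmetric]
        matrix_vector_mul_assoc[symmetric] outer matrix_vector_mult_scaleR)
  then show ?thesis using EC by simp
qed

lemma bounded_linear_transpose: "bounded_linear (transpose :: real^'n^'m \<Rightarrow> real^'m^'n)"
  unfolding linear_conv_bounded_linear[symmetric]
  by (auto intro!: linearI simp: transpose_def vec_eq_iff)

lemma matrix_inv_inverse:
  assumes "invertible A"
  shows "A ** matrix_inv A = mat 1" "matrix_inv A ** A = mat 1"
proof -
  have "A ** matrix_inv A = mat 1 \<and> matrix_inv A ** A = mat 1"
    unfolding matrix_inv_def using assms unfolding invertible_def by (rule someI_ex)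
  then show "A ** matrix_inv A = mat 1" "matrix_inv A ** A = mat 1" by auto
qed

lemma matrix_inv_transpose:
  fixes R :: "real^'a^'a"
  assumes "invertible R"
  shows "matrix_inv (transpose R) = transpose (matrix_inv R)"
proof -
  have l: "transpose (matrix_inv R) ** transpose R = mat 1" and r: "transpose R ** transpose (matrix_inv R) = mat 1"
    using matrix_inv_inverse[OF assms] by (simp_all add: matrix_transpose_mul[symmetric] transpose_mat)
  then have "invertible (transpose R)" unfolding invertible_def by blast
  then have "matrix_inv (transpose R) = (transpose (matrix_inv R) ** transpose R) ** matrix_inv (transpose R)"
    unfolding l by simp
  also have "\<dots> = transpose (matrix_inv R)"
    using matrix_inv_inverse[OF \<open>invertible (transpose R)\<close>] by (simp add: matrix_mul_assoc[symmetric])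
  finally show ?thesis .
qed

lemma matrix_inv_mult_vector: "invertible R \<Longrightarrow> matrix_inv R *v (R *v u) = u"
  by (simp add: matrix_vector_mul_assoc matrix_inv_inverse)

lemma orth_mult_vector:
  assumes "invertible R"
  shows "orth R X *v (R *v u) = matrix_inv (transpose R) *v (X *v u)"
  unfolding orth_def matrix_vector_mul_assoc[symmetric] matrix_inv_mult_vector[OF assms] ..

lemma inner_orth:
  fixes R X :: "real^'a^'a"
  assumes "invertible R"
  shows "(R *v u) \<bullet> (orth R X *v (R *v u)) = u \<bullet> (X *v u)"
proof -
  have "(R *v u) \<bullet> (transpose (matrix_inv R) *v y) = (matrix_inv R *v (R *v u)) \<bullet> y" for y
    by (metis dot_lmul_matrix inner_commute transpose_transpose vector_transpose_matrix)
  then show ?thesis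
    unfolding orth_mult_vector[OF assms] matrix_inv_transpose[OF assms] matrix_inv_mult_vector[OF assms] by simp
qed

lemma orth_add: "orth R (X + Y) = orth R X + orth R Y"
  by (simp add: orth_def bounded_bilinear.add_left[OF bounded_bilinear_matrix_matrix_mult] matrix_add_ldistrib)

lemma transpose_orth:
  assumes "invertible R"
  shows "transpose (orth R X) = orth R (transpose X)"
  by (simp add: orth_def matrix_inv_transpose[OF assms] matrix_transpose_mul matrix_mul_assoc)

section \<open>Equivalence of the two equations\<close>

theorem proposition6p7:
  fixes P :: "('m::{finite,linorder}, 'd::finite) system"
    and D :: "('d, 'f::finite, 'n::{finite,linorder}) element"
    and cH CH :: real and n :: nat
    and T :: "real set" and t :: real
    and U :: "real \<Rightarrow> real^('n \<times> 'm)"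
    and R :: "real \<Rightarrow> real^('n \<times> 'm)^('n \<times> 'm)"
    and QH :: "real^('n \<times> 'm)"
  assumes "energy_system P cH CH" and "cpg_element D n"
    and "open T" and "t \<in> T"
    and "U differentiable (at t)"
    and "\<forall>s\<in>T. \<forall>x \<in> nodes (Qvol D) \<union> nodes (Qhi D). u_p D (U s) x \<in> adm P"
    and "\<forall>s\<in>T. cholesky_factor (mass_op P D (U s)) (R s)"
    and "R t *v U t \<noteq> 0"
  defines "Ud \<equiv> vector_derivative U (at t)"
    and "Uo \<equiv> R t *v U t"
    and "Uod \<equiv> vector_derivative (\<lambda>s. R s *v U s) (at t)"
    and "S \<equiv> vector_derivative R (at t) ** matrix_inv (R t)"
    and "No \<equiv> orth (R t) (N_op P D (U t))"
    and "Vo \<equiv> orth (R t) (V_op P D (U t))"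
    and "Bo \<equiv> orth (R t) (B_op P D (U t))"
    and "BDo \<equiv> orth (R t) (BD_op P D (U t))"
    and "Mdo \<equiv> orth (R t) (mass_dot P D U t)"
    and "Qo \<equiv> matrix_inv (transpose (R t)) *v QH"
  defines "C \<equiv> (1/2) *\<^sub>R (Mdo + Vo + BDo)"
    and "\<gamma> \<equiv> (Uo \<bullet> ((Vo + BDo) *v Uo)) / (2 * norm Uo ^ 2)"
  defines "F \<equiv> matrix_inv (transpose (R t)) *v ((B_op P D (U t) - N_op P D (U t)) *v U t - QH)
                 - \<gamma> *\<^sub>R Uo"
  shows "Uod = - ((skw No - skw S - K_EC Uo C) *v Uo)
             + (1/2) *\<^sub>R ((Bo + BDo) *v Uo) - (Qo + BDo *v Uo)
         \<longleftrightarrow> R t *v Ud + L_fun P D (U t) Ud *\<^sub>R Uo = F"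
proof -
  interpret energy_system P cH CH by fact
  interpret cpg_element D n by fact
  let ?M = "\<lambda>s. mass_op P D (U s)"
  have U: "U differentiable (at t)" by fact
  have chol: "cholesky_factor (?M s) (R s)" if "s \<in> T" for s using assms that by blast
  have adm: "u_p D (U t) x \<in> adm P" if "x \<in> nodes (Qvol D) \<union> nodes (Qhi D)" for x
    using assms that by blast
  have M_deriv: "(?M has_vector_derivative mass_dot P D U t) (at t)"
    by (rule mass_op_has_vector_derivative[OF U adm]) simp
  have inv: "invertible (R t)" using chol[OF \<open>t \<in> T\<close>] by (rule cholesky_factor_invertible)
  have Uo0: "Uo \<noteq> 0" unfolding Uo_def by fact
  define Rd where "Rd = vector_derivative R (at t)"
  have "R differentiable (at t)"
    by (rule cholesky_factor_differentiable[OF \<open>open T\<close> \<open>t \<in> T\<close> differentiableI_vector[OF M_deriv] chol])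
  then have Rd: "(R has_vector_derivative Rd) (at t)" by (simp add: Rd_def vector_derivative_works)
  have Ud: "(U has_vector_derivative Ud) (at t)" using U by (simp add: Ud_def vector_derivative_works)

  have Uod: "Uod = R t *v Ud + Rd *v U t"
    unfolding Uod_def
    by (intro vector_derivative_at bounded_bilinear.has_vector_derivative[OF bounded_bilinear_matrix_vector_mult Rd Ud])
  have SUo: "S *v Uo = Rd *v U t"
    unfolding S_def Uo_def Rd_def matrix_vector_mul_assoc[symmetric] matrix_inv_mult_vector[OF inv] ..

  have Mdot: "mass_dot P D U t = transpose (R t) ** Rd + transpose Rd ** R t"
  proof -
    have "((\<lambda>s. transpose (R s)) has_vector_derivative transpose Rd) (at t)"
      using Rd by (rule bounded_linear.has_vector_derivative[OF bounded_linear_transpose])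
    then have "((\<lambda>s. transpose (R s) ** R s) has_vector_derivative transpose (R t) ** Rd + transpose Rd ** R t) (at t)"
      using Rd by (rule bounded_bilinear.has_vector_derivative[OF bounded_bilinear_matrix_matrix_mult])
    then have "(?M has_vector_derivative transpose (R t) ** Rd + transpose Rd ** R t) (at t)"
      by (rule has_vector_derivative_transform_within_open[OF _ \<open>open T\<close> \<open>t \<in> T\<close>])
         (simp add: cholesky_factorD(1)[OF chol, symmetric])
    then show ?thesis using M_deriv by (metis vector_derivative_at)
  qed
  have Mdo: "Mdo = S + transpose S"
  proof -
    let ?W = "matrix_inv (transpose (R t))"
    have W: "?W ** transpose (R t) = mat 1"
      unfolding matrix_inv_transpose[OF inv] matrix_transpose_mul[symmetric] matrix_inv_inverse[OF inv] transpose_mat ..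
    have "orth (R t) (transpose (R t) ** Rd) = (?W ** transpose (R t)) ** S"
      by (simp add: orth_def S_def Rd_def matrix_mul_assoc)
    moreover have "orth (R t) (transpose Rd ** R t) = transpose S ** (R t ** matrix_inv (R t))"
      by (simp add: orth_def S_def Rd_def matrix_mul_assoc matrix_transpose_mul matrix_inv_transpose[OF inv])
    ultimately show ?thesis
      unfolding Mdo_def Mdot orth_add W matrix_inv_inverse[OF inv] by simp
  qed
  note mv = matrix_vector_mult_add_rdistrib matrix_vector_mult_diff_rdistrib scaleR_matrix_vector_assoc[symmetric]
  \<comment> \<open>The half of Mdo in C supplies the symmetric part of S.\<close>
  have skwS: "(skw S *v Uo) $ i + (Mdo *v Uo) $ i / 2 = (S *v Uo) $ i" for i
    by (simp add: skw_def Mdo mv field_simps)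

  have sbp: "No + transpose No + Vo = Bo"
    unfolding No_def Vo_def Bo_def transpose_orth[OF inv] orth_add[symmetric]
    using summation_by_parts[OF assms(1,2), of "U t"] adm by simp
  have skwN: "(skw No *v Uo) $ i = (No *v Uo) $ i - (Bo *v Uo) $ i / 2 + (Vo *v Uo) $ i / 2" for i
    by (simp add: skw_def sbp[symmetric] mv field_simps)

  have norm_Uo: "norm Uo ^ 2 = U t \<bullet> (?M t *v U t)"
    unfolding cholesky_factorD(1)[OF chol[OF \<open>t \<in> T\<close>]] Uo_def power2_norm_eq_inner matrix_vector_mul_assoc[symmetric]
    by (metis dot_lmul_matrix vector_transpose_matrix inner_commute)
  have L: "L_fun P D (U t) Ud = (Uo \<bullet> (Mdo *v Uo)) / (2 * norm Uo ^ 2)"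
    unfolding L_fun_def Ud_def mass_dot_eq_mass_dir[OF U, symmetric] norm_Uo Mdo_def
    unfolding Uo_def inner_orth[OF inv] ..
  have C: "C *v Uo = (1/2) *\<^sub>R (Mdo *v Uo + Vo *v Uo + BDo *v Uo)"
    by (simp add: C_def mv)
  have rho: "(Uo \<bullet> (C *v Uo)) / norm Uo ^ 2 = L_fun P D (U t) Ud + \<gamma>"
    unfolding L C \<gamma>_def by (simp add: mv inner_add_right add_divide_distrib)
  have K: "K_EC Uo C *v Uo = C *v Uo - (L_fun P D (U t) Ud + \<gamma>) *\<^sub>R Uo"
    unfolding K_EC_vector[OF Uo0] rho ..

  have F: "F = Bo *v Uo - No *v Uo - Qo - \<gamma> *\<^sub>R Uo"
    unfolding F_def Bo_def No_def Qo_def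
    by (subst (1 2) Uo_def) (simp add: orth_mult_vector[OF inv] matrix_vector_mult_diff_distrib mv)
  \<comment> \<open>The terms with BDo cancel: one half comes from C, one half from the boundary term.\<close>
  have rhs: "- ((skw No - skw S - K_EC Uo C) *v Uo) + (1/2) *\<^sub>R ((Bo + BDo) *v Uo) - (Qo + BDo *v Uo)
    = S *v Uo + (F - L_fun P D (U t) Ud *\<^sub>R Uo)" (is "?l = ?r")
  proof -
    have "?l $ i = ?r $ i" for i
      using skwS[of i] by (simp add: mv K C F skwN algebra_simps add_divide_distrib)
    then show ?thesis unfolding vec_eq_iff by blast
  qed
  show ?thesis unfolding rhs Uod SUo[symmetric]
    by (simp only: add.commute[of "R t *v Ud" "S *v Uo"] add_left_cancel eq_diff_eq)
qed

end
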